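(* Let $k\ge 1$, $n\ge 2$, $d\ge 3$ be integers, let $r=\lfloor d/2\rfloor$ and $\Phi_r(x)=1+x+x^2+\dots+x^{r-1}$. Let $B_{n+1,k+1}(d)$ be a symmetric block graph of diameter $d$ in which every block is a clique of size $n+1$ and every cut vertex lies in exactly $k+1$ blocks. Then, if $d$ is even, $$hc\big(B_{n+1,k+1}(d)\big)= n^2(k+1)\left[\Phi_r(kn)\big((k+1)\Phi_r(kn)-2r\big)+\frac{2(\Phi_r(kn)-r)}{kn-1}\right]+n,$$ and if $d$ is odd, $$hc\big(B_{n+1,k+1}(d)\big)= kn^2(n+1)\left[\Phi_r(kn)\big(k(n+1)\Phi_r(kn)-2r+1\big)+\frac{2(\Phi_r(kn)-r)}{kn-1}\right].$$
   Context: A block graph is a connected graph all of whose blocks are cliques. A symmetric block graph $B_{m,l}(d)$ is a block graph with at least two blocks and diameter $d$, such that all blocks are cliques of size $m$, each cut vertex lies in exactly $l$ blocks, and all end vertices (vertices that are not cut vertices) have the same eccentricity. For a graph $G$ of order $p$, $D(u,v)$ is the length of a longest $u$–$v$ path; a hamiltonian coloring is a map $c:V(G)\to\{0,1,2,\dots\}$ with $D(u,v)+|c(u)-c(v)|\ge p-1$ for all distinct $u,v$; $hc(c)=\max_v c(v)$, and $hc(G)$ is the minimum of $hc(c)$ over all hamiltonian colorings $c$ of $G$ (colors start at $0$). *)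

theory Defs
  imports "Graph_Theory.Graph_Theory"
begin

text \<open>
  Finite simple undirected graphs are the symmetric digraphs of locale \<^locale>\<open>graph\<close>; each edge is a
  pair of opposite arcs, so the length of a path is its number of arcs.
\<close>

definition cut_vertex :: "('a, 'b) pre_digraph \<Rightarrow> 'a \<Rightarrow> bool" where
  "cut_vertex G v \<longleftrightarrow> v \<in> verts G \<and>
     (\<exists>u \<in> verts G - {v}. \<exists>w \<in> verts G - {v}.
        reachable G u w \<and> \<not> reachable (pre_digraph.del_vert G v) u w)"

text \<open>
  Subgraphs of a symmetric digraph need not be symmetric, hence the conjunct \<^term>\<open>graph H\<close>.
\<close>

definition blocks :: "('a, 'b) pre_digraph \<Rightarrow> ('a, 'b) pre_digraph set" where
  "blocks G = {B. pre_digraph.max_subgraph G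
     (\<lambda>H. graph H \<and> connected H \<and> (\<forall>v. \<not> cut_vertex H v)) B}"

definition block_graph :: "('a, 'b) pre_digraph \<Rightarrow> bool" where
  "block_graph G \<longleftrightarrow> graph G \<and> connected G \<and>
     (\<forall>B \<in> blocks G. complete_digraph (card (verts B)) B)"

definition distance :: "('a, 'b) pre_digraph \<Rightarrow> 'a \<Rightarrow> 'a \<Rightarrow> ereal" where
  "distance G u v = wf_digraph.\<mu> G (\<lambda>_. 1) u v"

definition eccentricity :: "('a, 'b) pre_digraph \<Rightarrow> 'a \<Rightarrow> ereal" where
  "eccentricity G v = (SUP u \<in> verts G. distance G v u)"

definition diameter :: "('a, 'b) pre_digraph \<Rightarrow> ereal" where
  "diameter G = (SUP v \<in> verts G. eccentricity G v)"

text \<open>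
  \<open>symmetric_block_graph m l d G\<close> states that \<open>G\<close> is a \<open>B\<^sub>m\<^sub>,\<^sub>l(d)\<close>.
\<close>

definition symmetric_block_graph :: "nat \<Rightarrow> nat \<Rightarrow> nat \<Rightarrow> ('a, 'b) pre_digraph \<Rightarrow> bool" where
  "symmetric_block_graph m l d G \<longleftrightarrow>
     block_graph G \<and>
     2 \<le> card (blocks G) \<and>
     diameter G = ereal (real d) \<and>
     (\<forall>B \<in> blocks G. complete_digraph m B) \<and>
     (\<forall>v. cut_vertex G v \<longrightarrow> card {B \<in> blocks G. v \<in> verts B} = l) \<and>
     (\<forall>u \<in> verts G. \<forall>v \<in> verts G. \<not> cut_vertex G u \<longrightarrow> \<not> cut_vertex G v \<longrightarrow>
        eccentricity G u = eccentricity G v)"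

definition longest_path_length :: "('a, 'b) pre_digraph \<Rightarrow> 'a \<Rightarrow> 'a \<Rightarrow> nat" where
  "longest_path_length G u v = Max {length p | p. pre_digraph.apath G u p v}"

text \<open>
  Colorings are total functions; only their values on \<^term>\<open>verts G\<close> matter.
\<close>

definition hamiltonian_coloring :: "('a, 'b) pre_digraph \<Rightarrow> ('a \<Rightarrow> nat) \<Rightarrow> bool" where
  "hamiltonian_coloring G c \<longleftrightarrow>
     (\<forall>u \<in> verts G. \<forall>v \<in> verts G. u \<noteq> v \<longrightarrow>
        int (longest_path_length G u v) + \<bar>int (c u) - int (c v)\<bar> \<ge> int (card (verts G)) - 1)"

definition hc_coloring :: "('a, 'b) pre_digraph \<Rightarrow> ('a \<Rightarrow> nat) \<Rightarrow> nat" where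
  "hc_coloring G c = Max (c ` verts G)"

definition hc :: "('a, 'b) pre_digraph \<Rightarrow> nat" where
  "hc G = (LEAST s. \<exists>c. hamiltonian_coloring G c \<and> hc_coloring G c = s)"

definition Phi :: "nat \<Rightarrow> real \<Rightarrow> real" where
  "Phi r x = (\<Sum>i<r. x ^ i)"

end

(*
  A path between u and v can be chosen to sweep all vertices of every block it meets, so in a block
  graph with blocks of order n + 1 the longest u-v path has length n times the distance of u and v.
  Call the central vertex (d even) or the central block (d odd) the root, let L be the distance to
  the root, and let e = 0 or e = 1 according to the parity of d. Distances are at most
  L(u) + L(v) + e, with equality when u and v are separated by the root. Enumerating the p vertices
  by increasing color therefore forces a gap of at least p - 1 - n (L(x_i) + L(x_{i+1}) + e) between
  consecutive colors, and summing up gives the lower bound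
  (p - 1)^2 - n (2 sum L + e (p - 1) - q), where q = 1 - e is the least possible value of
  L(x_0) + L(x_{p-1}). It is attained by running cyclically through the branches at the root: then
  consecutive vertices are separated by the root, vertices two steps apart are almost so, and three
  gaps together already suffice for any pair. That the eccentricities of all end vertices agree
  makes every branch at the root a complete kn-ary tree of blocks, whence p and sum L.
*)
theory Submission
  imports Defs
begin

section \<open>Trees of cliques\<close>

text \<open>Deleting the edges inside a block leaves components that each meet it in a single
  vertex, the gate. This projection is all that is kept of the block structure. Distances add up
  along gates, and so do longest paths: a path crosses each of the \<open>d u v\<close> blocks on
  its way once and gains at most \<open>n\<close> edges there. The coloring problem thus only
  involves \<open>n * d u v\<close>.

  The delicate ordering is that for even diameter and \<open>k = 1\<close>. Only two blocks meet at
  the center, so vertices two steps apart share a block there. They are kept in different branches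
  of it, which costs one in distance; the two gaps between them absorb the loss. This is why two
  round robins are nested, one over blocks and one over branches.

  The fraction in the theorem is the closed form of the sum of \<open>(i + 1) * (k * n) ^ i\<close>,
  which measures the levels in a branch.\<close>

text \<open>
  Blocks are given by their vertex sets. The vertex \<^term>\<open>gate B v\<close> is the one at which \<open>v\<close> is
  attached to \<open>B\<close>; that it is constant on every other block expresses that the blocks are glued
  together in a tree-like fashion.
\<close>

locale clique_tree =
  fixes V :: "'a set" and BB :: "'a set set" and gate :: "'a set \<Rightarrow> 'a \<Rightarrow> 'a" and n :: nat
  assumes fin_V: "finite V" and n_pos: "n \<ge> 1"
    and block_sub: "B \<in> BB \<Longrightarrow> B \<subseteq> V"
    and block_card: "B \<in> BB \<Longrightarrow> card B = Suc n"
    and gate_in: "\<lbrakk>B \<in> BB; v \<in> V\<rbrakk> \<Longrightarrow> gate B v \<in> B"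
    and gate_id: "\<lbrakk>B \<in> BB; v \<in> B\<rbrakk> \<Longrightarrow> gate B v = v"
    and gate_block: "\<lbrakk>B \<in> BB; B' \<in> BB; B \<noteq> B'; x \<in> B'; y \<in> B'\<rbrakk> \<Longrightarrow> gate B x = gate B y"
    and conn: "\<lbrakk>u \<in> V; v \<in> V\<rbrakk> \<Longrightarrow> (\<lambda>x y. x \<noteq> y \<and> (\<exists>B\<in>BB. x \<in> B \<and> y \<in> B))\<^sup>*\<^sup>* u v"
begin

definition adj :: "'a \<Rightarrow> 'a \<Rightarrow> bool" where
  "adj x y \<longleftrightarrow> x \<noteq> y \<and> (\<exists>B\<in>BB. x \<in> B \<and> y \<in> B)"

lemma adj_sym: "adj x y \<Longrightarrow> adj y x"
  unfolding adj_def by auto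

lemma adj_V: "adj x y \<Longrightarrow> x \<in> V \<and> y \<in> V"
  unfolding adj_def using block_sub by blast

lemma adjI: "\<lbrakk>B \<in> BB; x \<in> B; y \<in> B; x \<noteq> y\<rbrakk> \<Longrightarrow> adj x y"
  unfolding adj_def by blast

text \<open>An edge lies in some block; if that is not \<open>B\<close>, its ends have the same
  gate. So a walk changes its gate only along an edge of \<open>B\<close> itself.\<close>

lemma gate_adj: "\<lbrakk>B \<in> BB; adj x y\<rbrakk> \<Longrightarrow> gate B x = gate B y \<or> (x \<in> B \<and> y \<in> B)"
  unfolding adj_def using gate_block by blast

lemma fin_BB: "finite BB"
  by (rule finite_subset[of _ "Pow V"]) (use fin_V block_sub in auto)

lemma fin_block: "B \<in> BB \<Longrightarrow> finite B"
  using block_card by (metis card.infinite nat.distinct(1))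

section \<open>Distances\<close>

definition d :: "'a \<Rightarrow> 'a \<Rightarrow> nat" where
  "d u v = (LEAST m. (adj ^^ m) u v)"

lemma ex_walk: "\<lbrakk>u \<in> V; v \<in> V\<rbrakk> \<Longrightarrow> \<exists>m. (adj ^^ m) u v"
  using conn[of u v] by (simp add: rtranclp_power adj_def[abs_def])

lemma d_walk: "\<lbrakk>u \<in> V; v \<in> V\<rbrakk> \<Longrightarrow> (adj ^^ d u v) u v"
  unfolding d_def by (metis LeastI_ex ex_walk)

lemma d_le: "(adj ^^ m) u v \<Longrightarrow> d u v \<le> m"
  unfolding d_def by (rule Least_le)

lemma d_self [simp]: "d u u = 0"
  using d_le[of 0 u u] by simp

lemma d_eq_0: "\<lbrakk>u \<in> V; v \<in> V\<rbrakk> \<Longrightarrow> d u v = 0 \<longleftrightarrow> u = v"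
  using d_walk[of u v] by auto

lemma relpowp_adj_sym: "(adj ^^ m) u v \<Longrightarrow> (adj ^^ m) v u"
proof (induction m arbitrary: v)
  case (Suc m)
  then obtain y where y: "(adj ^^ m) u y" "adj y v" by auto
  have "(adj ^^ Suc m) v u"
    by (rule relpowp_Suc_I2[OF adj_sym[OF y(2)] Suc.IH[OF y(1)]])
  then show ?case .
qed auto

lemma d_sym: "d u v = d v u"
  unfolding d_def using relpowp_adj_sym by metis

lemma d_triangle: "\<lbrakk>u \<in> V; v \<in> V; w \<in> V\<rbrakk> \<Longrightarrow> d u w \<le> d u v + d v w"
  by (rule d_le[OF relpowp_trans[OF d_walk d_walk]])

lemma d_adj: "adj u v \<Longrightarrow> d u v = 1"
proof -
  assume a: "adj u v"
  then have "d u v \<le> 1" by (intro d_le) auto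
  moreover have "d u v \<noteq> 0" using a adj_V d_eq_0 adj_def by metis
  ultimately show ?thesis by simp
qed

text \<open>Before its first edge inside \<open>B\<close> the walk keeps the gate of
  \<open>x\<close>, hence enters \<open>B\<close> there; likewise it finally leaves \<open>B\<close>
  at the gate of \<open>y\<close>. Different gates force an edge of \<open>B\<close> in
  between.\<close>

lemma gate_cross:
  assumes B: "B \<in> BB" and y: "y \<in> V"
  shows "\<lbrakk>(adj ^^ m) x y; gate B x \<noteq> gate B y\<rbrakk> \<Longrightarrow>
    \<exists>m1 m2. m1 + 1 + m2 \<le> m \<and> (adj ^^ m1) x (gate B x) \<and> (adj ^^ m2) (gate B y) y"
proof (induction m arbitrary: x)
  case 0
  then show ?case by auto
next
  case (Suc m)
  from Suc.prems(1) obtain z where z: "adj x z" "(adj ^^ m) z y"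
    by (metis relpowp_Suc_D2)
  consider "gate B x = gate B z" | "x \<in> B" "z \<in> B"
    using gate_adj[OF B z(1)] by blast
  then show ?case
  proof cases
    case 1
    then obtain m1 m2 where m: "m1 + 1 + m2 \<le> m" "(adj ^^ m1) z (gate B z)" "(adj ^^ m2) (gate B y) y"
      using Suc.IH[OF z(2)] Suc.prems(2) by auto
    have "(adj ^^ Suc m1) x (gate B x)"
      using relpowp_Suc_I2[OF z(1) m(2)] 1 by simp
    then show ?thesis using m by (metis add_Suc not_less_eq_eq)
  next
    case 2
    show ?thesis
    proof (cases "gate B z = gate B y")
      case True
      then have "gate B y = z" using 2 gate_id B by auto
      then show ?thesis using z 2 gate_id[OF B 2(1)]
        by (intro exI[of _ 0] exI[of _ m]) auto
    next
      case False
      then obtain m1 m2 where m: "m1 + 1 + m2 \<le> m" "(adj ^^ m2) (gate B y) y"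
        using Suc.IH[OF z(2)] by auto
      then show ?thesis using 2 gate_id[OF B 2(1)]
        by (intro exI[of _ 0] exI[of _ m2]) auto
    qed
  qed
qed

text \<open>One direction is the triangle inequality; for the other, \<open>gate_cross\<close> cuts
  a geodesic at both gates.\<close>

lemma d_gates:
  assumes B: "B \<in> BB" and x: "x \<in> V" and y: "y \<in> V" and ne: "gate B x \<noteq> gate B y"
  shows "d x y = d x (gate B x) + 1 + d (gate B y) y"
proof (rule antisym)
  let ?a = "gate B x" and ?b = "gate B y"
  have ab: "?a \<in> B" "?b \<in> B" using gate_in B x y by auto
  then have V: "?a \<in> V" "?b \<in> V" using block_sub B by auto
  have 1: "d ?a ?b = 1" using ab ne B by (intro d_adj adjI)
  show "d x y \<le> d x ?a + 1 + d ?b y"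
    using d_triangle[OF x V(1) y] d_triangle[OF V y] 1 by linarith
  obtain m1 m2 where m: "m1 + 1 + m2 \<le> d x y" "(adj ^^ m1) x ?a" "(adj ^^ m2) ?b y"
    using gate_cross[OF B y d_walk[OF x y] ne] by blast
  then show "d x ?a + 1 + d ?b y \<le> d x y"
    using d_le[OF m(2)] d_le[OF m(3)] by linarith
qed

lemma d_block:
  assumes "B \<in> BB" "x \<in> B" "v \<in> V" "gate B v \<noteq> x"
  shows "d x v = 1 + d (gate B v) v"
proof -
  have "x \<in> V" using assms block_sub by auto
  then show ?thesis using d_gates[of B x v] assms gate_id by auto
qed

lemma d_le_gates:
  assumes B: "B \<in> BB" and x: "x \<in> V" and y: "y \<in> V"
  shows "d x y \<le> d (gate B x) x + d (gate B y) y + 1"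
proof (cases "gate B x = gate B y")
  case True
  have "gate B x \<in> V" using gate_in block_sub B x by auto
  then show ?thesis using d_triangle[OF x _ y, of "gate B x"] True d_sym by (metis trans_le_add1)
next
  case False
  then show ?thesis using d_gates[OF B x y] d_sym by simp
qed

lemma geodesic_split:
  assumes "u \<in> V" "v \<in> V" "d u v = a + b"
  obtains w where "w \<in> V" "d u w = a" "d w v = b"
proof -
  from d_walk[OF assms(1,2)] assms(3) have "(adj ^^ (a + b)) u v" by simp
  then obtain w where w: "(adj ^^ a) u w" "(adj ^^ b) w v"
    by (auto simp: relpowp_add)
  have wV: "w \<in> V"
  proof (cases a)
    case 0 then show ?thesis using w assms by simp
  next
    case (Suc a') then show ?thesis using w adj_V by auto
  qed
  have "d u w \<le> a" "d w v \<le> b" using w d_le by auto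
  with d_triangle[OF assms(1) wV assms(2)] assms(3) wV that show ?thesis by force
qed

text \<open>The block of the first edge of a geodesic works: if \<open>v\<close> had gate
  \<open>u\<close> there, the second vertex would be farther from \<open>v\<close> than
  \<open>u\<close> is.\<close>

lemma ex_leaving_block:
  assumes "u \<in> V" "v \<in> V" "u \<noteq> v"
  obtains B where "B \<in> BB" "u \<in> B" "gate B v \<noteq> u"
proof -
  have "d u v \<noteq> 0" using assms d_eq_0 by auto
  then obtain m where m: "d u v = 1 + m" by (metis Suc_pred' not_gr_zero plus_1_eq_Suc)
  obtain y where y: "y \<in> V" "d u y = 1" "d y v = m"
    by (rule geodesic_split[OF assms(1,2) m])
  have "(adj ^^ 1) u y" using d_walk[OF assms(1) y(1)] y(2) by simp
  then have "adj u y" by (simp add: eq_OO)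
  then obtain B where B: "B \<in> BB" "u \<in> B" "y \<in> B" "u \<noteq> y" unfolding adj_def by auto
  have "gate B v \<noteq> u"
    using d_block[OF B(1,3) assms(2)] B y m by auto
  with B that show ?thesis by auto
qed

text \<open>A vertex lies beyond at most one of the blocks at \<open>x\<close>. Otherwise the step
  from \<open>x\<close> to its gate \<open>z\<close> in \<open>B2\<close> approaches
  \<open>v\<close>, although every way from \<open>z\<close> to \<open>v\<close> enters
  \<open>B1\<close> through \<open>x\<close>.\<close>

lemma gate_other_block:
  assumes B1: "B1 \<in> BB" "x \<in> B1" and B2: "B2 \<in> BB" "x \<in> B2" and ne: "B1 \<noteq> B2"
    and v: "v \<in> V" "gate B1 v \<noteq> x"
  shows "gate B2 v = x"
proof (rule ccontr)
  define y where "y = gate B1 v"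
  define z where "z = gate B2 v"
  assume "gate B2 v \<noteq> x"
  then have zx: "z \<noteq> x" by (simp add: z_def)
  have z: "z \<in> B2" "z \<in> V" using gate_in B2 v block_sub by (auto simp: z_def)
  have "gate B1 z = x"
    using gate_block[OF B1(1) B2(1) ne z(1) B2(2)] gate_id B1 by simp
  then have "d z v = d z x + 1 + d y v"
    using d_gates[OF B1(1) z(2) v(1)] v(2) y_def by auto
  moreover have "d x v = 1 + d y v" using d_block[OF B1 v] y_def by simp
  moreover have "d x v = 1 + d z v" using d_block[OF B2 v(1)] zx z_def by simp
  ultimately show False by simp
qed

section \<open>Longest paths\<close>

text \<open>Paths are vertex lists, so \<open>length xs\<close> exceeds the number of arcs by one;
  this is the \<open>Suc\<close> in the length bounds below.\<close>

definition is_path :: "'a \<Rightarrow> 'a list \<Rightarrow> 'a \<Rightarrow> bool" where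
  "is_path u xs v \<longleftrightarrow> xs \<noteq> [] \<and> hd xs = u \<and> last xs = v \<and> set xs \<subseteq> V \<and> successively adj xs \<and> distinct xs"

text \<open>Once the walk is in \<open>B\<close>, the claim holds even without a change of gate; the
  disjunction keeps the induction hypothesis applicable after an edge of \<open>B\<close>.\<close>

lemma gate_in_walk:
  assumes B: "B \<in> BB"
  shows "\<lbrakk>xs \<noteq> []; successively adj xs; gate B (hd xs) \<noteq> gate B (last xs) \<or> hd xs \<in> B\<rbrakk>
     \<Longrightarrow> gate B (last xs) \<in> set xs"
proof (induction xs)
  case (Cons x xs)
  show ?case
  proof (cases xs)
    case Nil
    then show ?thesis using Cons.prems gate_id B by auto
  next
    case (Cons y ys)
    then have a: "adj x y" "successively adj xs" using Cons.prems by auto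
    show ?thesis
    proof (cases "x \<in> B \<and> y \<in> B")
      case True
      then show ?thesis using Cons.IH a Cons by auto
    next
      case False
      then have eq: "gate B x = gate B y" using gate_adj[OF B a(1)] by auto
      show ?thesis
      proof (cases "gate B y = gate B (last xs)")
        case True
        then have "x \<in> B" using Cons.prems(3) eq Cons by simp
        then show ?thesis using True eq gate_id[OF B, of x] Cons by simp
      next
        case False
        then have "gate B (last xs) \<in> set xs" using Cons.IH a(2) Cons by simp
        then show ?thesis using Cons by simp
      qed
    qed
  qed
qed simp

lemma entry_in_walk:
  assumes B: "B \<in> BB"
  shows "\<lbrakk>xs \<noteq> []; successively adj xs; last xs \<in> B\<rbrakk> \<Longrightarrow> gate B (hd xs) \<in> set xs"
proof (induction xs)
  case (Cons x xs)
  show ?case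
  proof (cases xs)
    case Nil
    then show ?thesis using Cons.prems gate_id B by auto
  next
    case (Cons y ys)
    then have a: "adj x y" "successively adj xs" "last xs \<in> B" using Cons.prems by auto
    show ?thesis using gate_adj[OF B a(1)] gate_id[OF B, of x] Cons.IH[OF _ a(2,3)] Cons by auto
  qed
qed simp

text \<open>A path leaving \<open>B\<close> at \<open>x\<close> could only come back through
  \<open>x\<close>, the gate of everything out there, and would repeat it.\<close>

lemma path_between_block_vertices:
  assumes B: "B \<in> BB"
  shows "\<lbrakk>xs \<noteq> []; successively adj xs; distinct xs; hd xs \<in> B; last xs \<in> B\<rbrakk> \<Longrightarrow> set xs \<subseteq> B"
proof (induction xs)
  case (Cons x xs)
  show ?case
  proof (cases xs)
    case Nil
    then show ?thesis using Cons.prems by auto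
  next
    case (Cons y ys)
    then have a: "adj x y" "successively adj xs" "last xs \<in> B" using Cons.prems by auto
    have "y \<in> B"
    proof (rule ccontr)
      assume "y \<notin> B"
      then have "gate B y = x" using gate_adj[OF B a(1)] gate_id[OF B, of x] Cons.prems by auto
      then have "x \<in> set xs" using entry_in_walk[OF B _ a(2,3)] Cons by auto
      then show False using Cons.prems by auto
    qed
    then show ?thesis using Cons.IH a Cons Cons.prems by auto
  qed
qed simp

text \<open>From a later vertex of \<open>B\<close> the path would still have to visit the gate of
  its end, that is \<open>g\<close>, which it has already used.\<close>

lemma path_beyond_gate:
  assumes B: "B \<in> BB" and "successively adj (g # zs)" "distinct (g # zs)"
    and g: "g = gate B (last (g # zs))"
  shows "set zs \<inter> B = {}"
proof (rule ccontr)
  assume "set zs \<inter> B \<noteq> {}"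
  then obtain y where y: "y \<in> set zs" "y \<in> B" by auto
  then obtain a b where ab: "zs = a @ y # b" by (auto simp: in_set_conv_decomp)
  have "successively adj (y # b)" using assms(2) ab
    by (auto simp: successively_Cons successively_append_iff)
  then have "gate B (last (y # b)) \<in> set (y # b)"
    using gate_in_walk[OF B, of "y # b"] y by auto
  moreover have "last (y # b) = last (g # zs)" using ab by simp
  ultimately show False using g assms(3) ab by auto
qed

lemma successively_in_block:
  assumes B: "B \<in> BB"
  shows "\<lbrakk>set xs \<subseteq> B; distinct xs\<rbrakk> \<Longrightarrow> successively adj xs"
proof (induction xs)
  case (Cons x xs)
  then show ?case using adjI[OF B] by (cases xs) auto
qed simp

text \<open>Cut the path at the gate of \<open>v\<close> in a block through which \<open>u\<close>
  leaves. The first part stays in this block, so it has at most \<open>n\<close> vertices before the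
  gate; the rest starts at distance one less.\<close>

lemma path_length_le:
  "\<lbrakk>u \<in> V; v \<in> V; is_path u xs v\<rbrakk> \<Longrightarrow> length xs \<le> Suc (n * d u v)"
proof (induction "d u v" arbitrary: u xs)
  case 0
  then have "u = v" using d_eq_0 by simp
  then have "xs = [u]" using 0 by (cases xs) (auto simp: is_path_def split: if_splits)
  then show ?case by simp
next
  case (Suc m)
  then have "u \<noteq> v" by auto
  then obtain B where B: "B \<in> BB" "u \<in> B" "gate B v \<noteq> u"
    using ex_leaving_block Suc.prems by metis
  define g where "g = gate B v"
  have gB: "g \<in> B" and gV: "g \<in> V" using gate_in B Suc.prems block_sub by (auto simp: g_def)
  have m: "d g v = m" using d_block[OF B(1,2) Suc.prems(2) B(3)] Suc.hyps(2) g_def by auto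
  have p: "xs \<noteq> []" "hd xs = u" "last xs = v" "set xs \<subseteq> V" "successively adj xs" "distinct xs"
    using Suc.prems by (auto simp: is_path_def)
  have "g \<in> set xs" using gate_in_walk[OF B(1) p(1,5)] p B g_def by auto
  then obtain ys zs where xs: "xs = ys @ g # zs" by (auto simp: in_set_conv_decomp)
  have "is_path g (g # zs) v" using p xs by (auto simp: is_path_def successively_append_iff)
  then have 1: "length (g # zs) \<le> Suc (n * m)" using Suc.hyps(1)[of g "g # zs"] m gV Suc.prems by auto
  have "successively adj (ys @ [g])" using p(5) xs
    by (auto simp: successively_append_iff)
  moreover have "hd (ys @ [g]) \<in> B" using p(2) xs gB B by (cases ys) auto
  ultimately have "set (ys @ [g]) \<subseteq> B"
    using path_between_block_vertices[OF B(1), of "ys @ [g]"] p(6) xs gB by auto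
  then have "card (set (ys @ [g])) \<le> card B" using card_mono fin_block B by blast
  moreover have "card (set (ys @ [g])) = Suc (length ys)" using p(6) xs by (subst distinct_card) auto
  ultimately have "length ys \<le> n" using block_card[OF B(1)] by simp
  then show ?case using 1 xs Suc.hyps(2)[symmetric] by simp
qed

lemma ex_longest_path:
  "\<lbrakk>u \<in> V; v \<in> V\<rbrakk> \<Longrightarrow> \<exists>xs. is_path u xs v \<and> length xs = Suc (n * d u v)"
proof (induction "d u v" arbitrary: u)
  case 0
  then have "u = v" using d_eq_0 by simp
  then show ?case using 0 by (intro exI[of _ "[u]"]) (auto simp: is_path_def)
next
  case (Suc m)
  then have "u \<noteq> v" by auto
  then obtain B where B: "B \<in> BB" "u \<in> B" "gate B v \<noteq> u"
    using ex_leaving_block Suc.prems by metis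
  define g where "g = gate B v"
  have gB: "g \<in> B" and gV: "g \<in> V" using gate_in B Suc.prems block_sub by (auto simp: g_def)
  have m: "d g v = m" using d_block[OF B(1,2) Suc.prems(2) B(3)] Suc.hyps(2) g_def by auto
  obtain ps where ps: "is_path g ps v" "length ps = Suc (n * m)"
    using Suc.hyps(1)[of g] m gV Suc.prems by auto
  then obtain zs where zs: "ps = g # zs" by (cases ps) (auto simp: is_path_def)
  have p: "last (g # zs) = v" "set (g # zs) \<subseteq> V" "successively adj (g # zs)" "distinct (g # zs)"
    using ps zs by (auto simp: is_path_def)
  have dis: "set zs \<inter> B = {}" using path_beyond_gate[OF B(1) p(3,4)] p(1) g_def by simp
  \<comment> \<open>The other \<open>n - 1\<close> vertices of the block are inserted between
    \<open>u\<close> and the gate. Nothing is repeated because \<open>zs\<close> avoids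
    \<open>B\<close>.\<close>
  obtain ws where ws: "set ws = B - {u, g}" "distinct ws"
    using finite_distinct_list[of "B - {u, g}"] fin_block[OF B(1)] by auto
  have "length ws = card (B - {u, g})" using ws by (metis distinct_card)
  also have "\<dots> = Suc n - 2" using B gB g_def block_card[OF B(1)] by (subst card_Diff_subset) auto
  finally have lws: "length ws = n - 1" by simp
  have sB: "successively adj (u # ws @ [g])"
    using B gB ws g_def by (intro successively_in_block[OF B(1)]) auto
  have "is_path u (u # ws @ g # zs) v"
    unfolding is_path_def
  proof (intro conjI)
    show "successively adj (u # ws @ g # zs)"
      using sB p(3) by (cases ws) (auto simp: successively_append_iff successively_Cons hd_append)
    show "set (u # ws @ g # zs) \<subseteq> V" using p(2) ws B Suc.prems block_sub[OF B(1)] by auto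
    show "distinct (u # ws @ g # zs)" using ws p(4) dis B g_def by auto
  qed (use p in auto)
  moreover have "length (u # ws @ g # zs) = Suc (n * d u v)"
    using lws ps(2) zs n_pos Suc.hyps(2)[symmetric] by simp
  ultimately show ?case by blast
qed

end

section \<open>Colorings from orderings\<close>

lemma sum_consecutive:
  fixes a :: "nat \<Rightarrow> int"
  shows "(\<Sum>i<m. a i + a (Suc i)) = 2 * (\<Sum>i\<le>m. a i) - a 0 - a m"
  by (induction m) (auto simp: algebra_simps)

text \<open>\<open>m\<close> will be the order minus one and \<open>N\<close> will be
  \<open>n\<close>. Adding up the least possible gaps counts every level twice, except those of the
  two ends.\<close>

lemma sum_gaps:
  fixes a :: "nat \<Rightarrow> int"
  shows "(\<Sum>i<m. int m - N * (a i + a (Suc i) + e))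
    = int m * int m - N * (2 * (\<Sum>i\<le>m. a i) + e * int m - a 0 - a m)"
proof -
  have "(\<Sum>i<m. int m - N * (a i + a (Suc i) + e))
      = int m * int m - N * ((\<Sum>i<m. a i + a (Suc i)) + e * int m)"
    by (simp add: sum_subtractf sum_distrib_left[symmetric] sum.distrib algebra_simps)
  then show ?thesis by (simp only: sum_consecutive) (simp add: algebra_simps)
qed

lemma ex_sorted_enumeration:
  fixes c :: "'a \<Rightarrow> nat"
  assumes "finite V" "card V = Suc m"
  obtains f where "bij_betw f {..m} V" "\<And>i. i < m \<Longrightarrow> c (f i) \<le> c (f (Suc i))"
proof -
  obtain xs0 where xs0: "set xs0 = V" "distinct xs0" using finite_distinct_list assms by metis
  define xs where "xs = sort_key c xs0"
  have xs: "set xs = V" "distinct xs" "sorted (map c xs)" using xs0 by (auto simp: xs_def)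
  have len: "length xs = Suc m" using xs assms distinct_card by metis
  have "bij_betw ((!) xs) {..<length xs} (set xs)" using xs(2) by (intro bij_betw_nth) auto
  then have "bij_betw ((!) xs) {..m} V" using xs len by (simp add: lessThan_Suc_atMost)
  moreover have "c (xs ! i) \<le> c (xs ! Suc i)" if "i < m" for i
    using sorted_nth_mono[OF xs(3), of i "Suc i"] len that by simp
  ultimately show ?thesis using that by blast
qed

text \<open>\<open>D\<close>, \<open>L\<close>, \<open>e\<close> and \<open>q\<close> stay abstract
  so that both parities are instances. Only the ends of the enumeration are counted once, which is
  where \<open>q\<close> enters.\<close>

lemma coloring_lower_bound:
  fixes D :: "'a \<Rightarrow> 'a \<Rightarrow> nat" and c L :: "'a \<Rightarrow> nat" and e N q :: int
  assumes V: "finite V" "card V = Suc m" "m \<ge> 1" and N: "N \<ge> 0"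
    and D: "\<And>u v. \<lbrakk>u \<in> V; v \<in> V; u \<noteq> v\<rbrakk> \<Longrightarrow> int (D u v) \<le> N * (int (L u) + int (L v) + e)"
    and q: "\<And>u v. \<lbrakk>u \<in> V; v \<in> V; u \<noteq> v\<rbrakk> \<Longrightarrow> q \<le> int (L u) + int (L v)"
    and c: "\<And>u v. \<lbrakk>u \<in> V; v \<in> V; u \<noteq> v\<rbrakk> \<Longrightarrow> int m \<le> int (D u v) + \<bar>int (c u) - int (c v)\<bar>"
  shows "int m * int m - N * (2 * int (sum L V) + e * int m - q) \<le> int (Max (c ` V))"
proof -
  obtain f where f: "bij_betw f {..m} V" and mono: "\<And>i. i < m \<Longrightarrow> c (f i) \<le> c (f (Suc i))"
    using ex_sorted_enumeration[OF V(1,2)] by blast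
  have fV: "f i \<in> V" if "i \<le> m" for i using f that by (auto simp: bij_betw_def)
  have fne: "f i \<noteq> f j" if "i \<le> m" "j \<le> m" "i \<noteq> j" for i j
    using f that by (auto simp: bij_betw_def inj_on_def)
  have "(\<Sum>i<m. int m - N * (int (L (f i)) + int (L (f (Suc i))) + e))
      \<le> (\<Sum>i<m. int (c (f (Suc i))) - int (c (f i)))"
  proof (rule sum_mono)
    fix i assume "i \<in> {..<m}"
    then have i: "i < m" by simp
    then have *: "f i \<in> V" "f (Suc i) \<in> V" "f i \<noteq> f (Suc i)" using fV fne by auto
    show "int m - N * (int (L (f i)) + int (L (f (Suc i))) + e) \<le> int (c (f (Suc i))) - int (c (f i))"
      using D[OF *] c[OF *] mono[OF i] by linarith
  qed
  also have "\<dots> = int (c (f m)) - int (c (f 0))" by (rule sum_lessThan_telescope)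
  also have "\<dots> \<le> int (c (f m))" by simp
  also have "\<dots> \<le> int (Max (c ` V))" using fV[of m] V by auto
  finally have 1: "(\<Sum>i<m. int m - N * (int (L (f i)) + int (L (f (Suc i))) + e)) \<le> int (Max (c ` V))" .
  have "(\<Sum>i\<le>m. int (L (f i))) = int (sum L V)"
    using sum.reindex_bij_betw[OF f, of L] by (simp flip: of_nat_sum)
  then have 2: "int m * int m - N * (2 * int (sum L V) + e * int m - int (L (f 0)) - int (L (f m))) \<le> int (Max (c ` V))"
    using 1 unfolding sum_gaps[where a = "\<lambda>i. int (L (f i))"] by simp
  \<comment> \<open>As \<open>m\<close> is positive, the two ends are distinct and \<open>q\<close>
    applies to them.\<close>
  have "q \<le> int (L (f 0)) + int (L (f m))" using V by (intro q fV fne) auto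
  then have "N * (2 * int (sum L V) + e * int m - int (L (f 0)) - int (L (f m)))
      \<le> N * (2 * int (sum L V) + e * int m - q)"
    using N by (intro mult_left_mono) auto
  then show ?thesis using 2 by linarith
qed

text \<open>
  When every gap is at least a third of what the closest pairs require, only pairs at most two
  steps apart in the ordering need to be inspected.
\<close>

lemma coloring_from_ordering:
  fixes D :: "'a \<Rightarrow> 'a \<Rightarrow> nat" and L :: "'a \<Rightarrow> nat" and e N :: int
  assumes f: "bij_betw f {..m} V" and N: "N \<ge> 0"
    and D_sym: "\<And>u v. D u v = D v u"
    and D1: "\<And>i. i < m \<Longrightarrow> N * (int (L (f i)) + int (L (f (Suc i))) + e) \<le> int (D (f i) (f (Suc i)))"
    and D2: "\<And>i. Suc i < m \<Longrightarrow> N * (int (L (f i)) + int (L (f (Suc (Suc i)))) + e - 1) \<le> int (D (f i) (f (Suc (Suc i))))"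
    and D3: "\<And>u v. \<lbrakk>u \<in> V; v \<in> V; u \<noteq> v\<rbrakk> \<Longrightarrow> N \<le> int (D u v)"
    and R: "\<And>v. v \<in> V \<Longrightarrow> L v \<le> R"
    and m1: "N * (2 * int R + e + 1) \<le> int m"
    and m3: "3 * (N * (2 * int R + e)) \<le> 2 * int m + N"
  obtains c :: "'a \<Rightarrow> nat"
  where "\<And>u v. \<lbrakk>u \<in> V; v \<in> V; u \<noteq> v\<rbrakk> \<Longrightarrow> int m \<le> int (D u v) + \<bar>int (c u) - int (c v)\<bar>"
    and "int (Max (c ` V)) = int m * int m - N * (2 * int (sum L V) + e * int m - int (L (f 0)) - int (L (f m)))"
proof -
  define l where "l i = int (L (f i))" for i
  \<comment> \<open>The gap for which the lower bound is tight; the colors are the partial sums,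
    starting from 0.\<close>
  define g where "g i = int m - N * (l i + l (Suc i) + e)" for i
  define C where "C i = (\<Sum>j<i. g j)" for i
  define c where "c v = nat (C (inv_into {..m} f v))" for v
  have fV: "f i \<in> V" if "i \<le> m" for i using f that by (auto simp: bij_betw_def)
  have fne: "f i \<noteq> f j" if "i \<le> m" "j \<le> m" "i \<noteq> j" for i j
    using f that by (auto simp: bij_betw_def inj_on_def)
  have lR: "N * l i \<le> N * int R" if "i \<le> m" for i
    using R[OF fV[OF that]] N unfolding l_def by (intro mult_left_mono) auto
  have g_ge: "int m - N * (2 * int R + e) \<le> g i" if "i < m" for i
    using lR[of i] lR[of "Suc i"] that by (simp add: g_def algebra_simps)
  have g0: "g i \<ge> 0" if "i < m" for i
    using g_ge[OF that] m1 N by (simp add: algebra_simps)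
  have Cmono: "C i \<le> C j" if "i \<le> j" "j \<le> m" for i j
    unfolding C_def using that g0 by (intro sum_mono2) auto
  have C0: "C i \<ge> 0" if "i \<le> m" for i using Cmono[of 0 i] that by (simp add: C_def)
  have CS: "C (Suc i) = C i + g i" for i by (simp add: C_def)
  have cf: "int (c (f i)) = C i" if "i \<le> m" for i
    using C0[OF that] that f by (simp add: c_def bij_betw_def inv_into_f_f)
  have ham: "int m \<le> int (D (f i) (f j)) + (C j - C i)" if ij: "i < j" "j \<le> m" for i j
  proof -
    consider "j = Suc i" | "j = Suc (Suc i)" | "Suc (Suc (Suc i)) \<le> j" using ij by linarith
    then show ?thesis
    proof cases
      case 1
      then show ?thesis using D1[of i] ij by (simp add: CS g_def l_def)
    next
      case 2
      \<comment> \<open>The levels of the two outer vertices cancel against the two gaps; twice the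
        level of the middle vertex remains, which \<open>m1\<close> controls.\<close>
      have "N * (l i + l (Suc (Suc i)) + e - 1) \<le> int (D (f i) (f j))"
        using D2[of i] ij 2 by (simp add: l_def)
      then show ?thesis using 2 m1 lR[of "Suc i"] ij by (simp add: CS g_def algebra_simps)
    next
      case 3
      \<comment> \<open>Three gaps amount to at least \<open>3 * (m - N * (2 * R + e))\<close>,
        hence to \<open>m - N\<close> by \<open>m3\<close>; the missing \<open>N\<close> is the
        least value of \<open>D\<close>.\<close>
      have "C (Suc (Suc (Suc i))) \<le> C j" using 3 ij Cmono by auto
      moreover have "N \<le> int (D (f i) (f j))" using D3 fV fne ij by auto
      ultimately show ?thesis
        using g_ge[of i] g_ge[of "Suc i"] g_ge[of "Suc (Suc i)"] 3 ij m3 unfolding CS by linarith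
    qed
  qed
  show ?thesis
  proof (rule that)
    fix u v assume uv: "u \<in> V" "v \<in> V" "u \<noteq> v"
    then obtain i j where ij: "i \<le> m" "j \<le> m" "u = f i" "v = f j"
      using f by (auto simp: bij_betw_def)
    show "int m \<le> int (D u v) + \<bar>int (c u) - int (c v)\<bar>"
    proof (cases "i < j")
      case True
      then show ?thesis using ham[of i j] Cmono[of i j] ij cf by auto
    next
      case False
      then have "j < i" using ij uv by (metis linorder_neqE_nat)
      then show ?thesis using ham[of j i] Cmono[of j i] ij cf D_sym[of u v] by auto
    qed
  next
    have "Max (c ` V) = c (f m)"
    proof (rule Max_eqI)
      show "finite (c ` V)" using f bij_betw_finite by blast
      show "c (f m) \<in> c ` V" using fV by auto
      fix x assume "x \<in> c ` V"
      then obtain i where "i \<le> m" "x = c (f i)" using f by (auto simp: bij_betw_def)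
      then show "x \<le> c (f m)" using Cmono[of i m] cf[of i] cf[of m] by simp
    qed
    then have "int (Max (c ` V)) = C m" using cf by simp
    also have "\<dots> = int m * int m - N * (2 * (\<Sum>i\<le>m. l i) + e * int m - l 0 - l m)"
      unfolding C_def g_def by (rule sum_gaps)
    also have "(\<Sum>i\<le>m. l i) = int (sum L V)"
      using sum.reindex_bij_betw[OF f, of L] unfolding l_def by (simp flip: of_nat_sum)
    finally show "int (Max (c ` V)) = int m * int m - N * (2 * int (sum L V) + e * int m - int (L (f 0)) - int (L (f m)))"
      by (simp add: l_def)
  qed
qed

section \<open>Round-robin orderings\<close>

lemma ex_enumeration_with_value:
  assumes "finite S" "card S = b" "i < b" "s \<in> S"
  obtains e where "bij_betw e {..<b} S" "e i = s"
proof -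
  obtain e0 where e0: "bij_betw e0 {..<b} S"
    using ex_bij_betw_nat_finite[OF assms(1)] assms(2) by (auto simp: atLeast0LessThan)
  then obtain i' where i': "i' < b" "e0 i' = s" using assms(4) by (auto simp: bij_betw_def)
  have "bij_betw (Transposition.transpose i i') {..<b} {..<b}"
    using assms(3) i' by (auto intro!: bij_betw_byWitness[of _ "Transposition.transpose i i'"] simp: Transposition.transpose_def)
  then have "bij_betw (e0 \<circ> Transposition.transpose i i') {..<b} S" using e0 by (rule bij_betw_trans)
  then show ?thesis using that[of "e0 \<circ> Transposition.transpose i i'"] i' by simp
qed

text \<open>Position \<open>i\<close> receives an element of class \<open>i mod N\<close>, so nearby
  positions fall into different classes. The ends are prescribed because their levels decide whether
  the lower bound is attained.\<close>

lemma ex_round_robin: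
  assumes S: "\<And>j. j < N \<Longrightarrow> finite (S j) \<and> card (S j) = b"
    and dis: "\<And>i j. \<lbrakk>i < N; j < N; i \<noteq> j\<rbrakk> \<Longrightarrow> S i \<inter> S j = {}"
    and N: "N \<ge> 2" and a: "a \<in> S 0" and z: "z \<in> S (N - 1)"
  shows "\<exists>F. bij_betw F {..<N * b} (\<Union>j<N. S j) \<and> (\<forall>i<N * b. F i \<in> S (i mod N))
    \<and> F 0 = a \<and> F (N * b - 1) = z"
proof -
  have b: "b \<ge> 1" using S[of 0] a N by (metis card_0_eq empty_iff less_one linorder_not_le not_numeral_le_zero gr_zeroI)
  have "\<exists>e. bij_betw e {..<b} (S j) \<and> (j = 0 \<longrightarrow> e 0 = a) \<and> (j = N - 1 \<longrightarrow> e (b - 1) = z)"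
    if j: "j < N" for j
  proof -
    consider "j = 0" | "j = N - 1" "j \<noteq> 0" | "j \<noteq> 0" "j \<noteq> N - 1" by blast
    then show ?thesis
    proof cases
      case 1
      obtain e where "bij_betw e {..<b} (S j)" "e 0 = a"
        using ex_enumeration_with_value[of "S j" b 0 a] S[OF j] b a 1 by auto
      then show ?thesis using 1 N by auto
    next
      case 2
      obtain e where "bij_betw e {..<b} (S j)" "e (b - 1) = z"
        using ex_enumeration_with_value[of "S j" b "b - 1" z] S[OF j] b z 2 by auto
      then show ?thesis using 2 by auto
    next
      case 3
      then show ?thesis using ex_bij_betw_nat_finite[of "S j"] S[OF j] by (auto simp: atLeast0LessThan)
    qed
  qed
  then obtain E where E: "\<And>j. j < N \<Longrightarrow> bij_betw (E j) {..<b} (S j)"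
    and E0: "E 0 0 = a" and E1: "E (N - 1) (b - 1) = z" using N by (metis (no_types, lifting) Suc_1 Suc_le_lessD diff_less less_numeral_extra(1) order_less_le_trans zero_less_Suc)
  define F where "F i = E (i mod N) (i div N)" for i
  have dv: "i div N < b" if "i < N * b" for i using that by (simp add: less_mult_imp_div_less mult.commute)
  have md: "i mod N < N" for i using N by simp
  have F_eq: "F (N * t + j) = E j t" if "j < N" for j t using that by (simp add: F_def)
  have FS: "F i \<in> S (i mod N)" if "i < N * b" for i
    using E[OF md] dv[OF that] unfolding F_def bij_betw_def by blast
  have "bij_betw F {..<N * b} (\<Union>j<N. S j)"
    unfolding bij_betw_def
  proof
    show "inj_on F {..<N * b}"
    proof (rule inj_onI)
      fix i j assume ij: "i \<in> {..<N * b}" "j \<in> {..<N * b}" "F i = F j"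
      have m: "i mod N = j mod N" using FS[of i] FS[of j] dis[OF md md, of i j] ij by auto
      then have "E (i mod N) (i div N) = E (i mod N) (j div N)" using ij(3) by (simp add: F_def)
      then have "i div N = j div N"
        using E[OF md, of i] dv[of i] dv[of j] ij(1,2) by (auto simp: bij_betw_def inj_on_def)
      then show "i = j" using m by (metis div_mult_mod_eq)
    qed
    show "F ` {..<N * b} = (\<Union>j<N. S j)"
    proof
      show "F ` {..<N * b} \<subseteq> (\<Union>j<N. S j)" using FS md by auto
      show "(\<Union>j<N. S j) \<subseteq> F ` {..<N * b}"
      proof
        fix x assume "x \<in> (\<Union>j<N. S j)"
        then obtain j where j: "j < N" "x \<in> S j" by auto
        then obtain t where t: "t < b" "x = E j t" using E[OF j(1)] by (auto simp: bij_betw_def)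
        have "N * t + j < N * Suc t" using j by simp
        also have "\<dots> \<le> N * b" using t by (intro mult_le_mono2) simp
        finally have "N * t + j < N * b" .
        moreover have "F (N * t + j) = x" using F_eq[OF j(1)] t by simp
        ultimately show "x \<in> F ` {..<N * b}" by (metis imageI lessThan_iff)
      qed
    qed
  qed
  moreover have "F 0 = a" using E0 by (simp add: F_def)
  moreover have "F (N * b - 1) = z"
  proof -
    \<comment> \<open>The last position closes the last full round and so belongs to class
      \<open>N - 1\<close>.\<close>
    have "N * b - 1 = N * (b - 1) + (N - 1)" using b N by (cases b) (auto simp: algebra_simps)
    then show ?thesis using F_eq[of "N - 1" "b - 1"] E1 N by simp
  qed
  ultimately show ?thesis using FS by blast
qed

section \<open>Branches\<close>

text \<open>
  Order of a branch of height \<open>h\<close> in which every inner vertex has \<open>x\<close> children, and sum of the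
  distances of its vertices to the root.
\<close>

fun branch_card :: "nat \<Rightarrow> nat \<Rightarrow> nat" where
  "branch_card x 0 = 1"
| "branch_card x (Suc h) = 1 + x * branch_card x h"

fun branch_weight :: "nat \<Rightarrow> nat \<Rightarrow> nat" where
  "branch_weight x 0 = 0"
| "branch_weight x (Suc h) = x * (branch_weight x h + branch_card x h)"

context clique_tree begin

definition deg :: "'a \<Rightarrow> nat" where
  "deg v = card {B \<in> BB. v \<in> B}"

text \<open>For \<open>x\<close> in \<open>B\<close>, this is the component of \<open>x\<close> once
  the edges inside \<open>B\<close> are removed.\<close>

definition branch :: "'a set \<Rightarrow> 'a \<Rightarrow> 'a set" where
  "branch B x = {v \<in> V. gate B v = x}"

lemma branch_V: "branch B x \<subseteq> V"
  by (auto simp: branch_def)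

lemma fin_branch: "finite (branch B x)"
  using finite_subset[OF branch_V fin_V] .

lemma root_in_branch: "\<lbrakk>B \<in> BB; x \<in> B\<rbrakk> \<Longrightarrow> x \<in> branch B x"
  using gate_id block_sub by (auto simp: branch_def)

lemma d_branch:
  "\<lbrakk>B \<in> BB; x \<in> B; y \<in> B; y \<noteq> x; v \<in> branch B y\<rbrakk> \<Longrightarrow> d x v = Suc (d y v)"
  using d_block[of B x v] by (auto simp: branch_def)

text \<open>A vertex with gate \<open>x\<close> in \<open>B\<close> leaves \<open>x\<close> through
  another block; the converse is \<open>gate_other_block\<close>. This is the recursion behind the
  counts.\<close>

lemma branch_minus_root:
  assumes B: "B \<in> BB" "x \<in> B"
  shows "branch B x - {x} = (\<Union>B'\<in>{B'\<in>BB. x \<in> B'} - {B}. \<Union>y\<in>B' - {x}. branch B' y)"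
proof (intro equalityI subsetI)
  fix v assume "v \<in> branch B x - {x}"
  then have v: "v \<in> V" "gate B v = x" "v \<noteq> x" by (auto simp: branch_def)
  obtain B' where B': "B' \<in> BB" "x \<in> B'" "gate B' v \<noteq> x"
    by (rule ex_leaving_block[OF subsetD[OF block_sub[OF B(1)] B(2)] v(1) v(3)[symmetric]])
  then have "B' \<noteq> B" using v by auto
  then show "v \<in> (\<Union>B'\<in>{B'\<in>BB. x \<in> B'} - {B}. \<Union>y\<in>B' - {x}. branch B' y)"
    using B' v gate_in[OF B'(1)] by (auto simp: branch_def)
next
  fix v assume "v \<in> (\<Union>B'\<in>{B'\<in>BB. x \<in> B'} - {B}. \<Union>y\<in>B' - {x}. branch B' y)"
  then obtain B' where B': "B' \<in> BB" "x \<in> B'" "B' \<noteq> B" "v \<in> V" "gate B' v \<noteq> x"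
    by (auto simp: branch_def)
  have "gate B v = x" using gate_other_block[OF B'(1,2) B B'(3-5)] .
  moreover have "v \<noteq> x" using B' gate_id by auto
  ultimately show "v \<in> branch B x - {x}" using B' by (auto simp: branch_def)
qed

lemma verts_minus_center:
  assumes "x \<in> V"
  shows "V - {x} = (\<Union>B'\<in>{B'\<in>BB. x \<in> B'}. \<Union>y\<in>B' - {x}. branch B' y)"
proof (intro equalityI subsetI)
  fix v assume "v \<in> V - {x}"
  then have v: "v \<in> V" "v \<noteq> x" by auto
  obtain B' where B': "B' \<in> BB" "x \<in> B'" "gate B' v \<noteq> x"
    by (rule ex_leaving_block[OF assms v(1) v(2)[symmetric]])
  then show "v \<in> (\<Union>B'\<in>{B'\<in>BB. x \<in> B'}. \<Union>y\<in>B' - {x}. branch B' y)"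
    using v gate_in[OF B'(1)] by (auto simp: branch_def)
qed (use gate_id in \<open>auto simp: branch_def\<close>)

lemma branches_disjoint:
  assumes "B1 \<in> BB" "x \<in> B1" "y1 \<in> B1 - {x}" "B2 \<in> BB" "x \<in> B2" "y2 \<in> B2 - {x}"
    and "(B1, y1) \<noteq> (B2, y2)"
  shows "branch B1 y1 \<inter> branch B2 y2 = {}"
proof (cases "B1 = B2")
  case True
  then show ?thesis using assms by (auto simp: branch_def)
next
  case False
  show ?thesis
  proof (rule ccontr)
    assume "branch B1 y1 \<inter> branch B2 y2 \<noteq> {}"
    then obtain v where v: "v \<in> V" "gate B1 v = y1" "gate B2 v = y2" by (auto simp: branch_def)
    then show False using gate_other_block[of B1 x B2 v] False assms by auto
  qed
qed

text \<open>With \<open>f\<close> constantly 1 this gives orders, with \<open>f = d x\<close> it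
  gives level sums; \<open>n\<close> counts the vertices of a block other than
  \<open>x\<close>.\<close>

lemma sum_branches:
  fixes f :: "'a \<Rightarrow> nat"
  assumes C: "C \<subseteq> {B \<in> BB. x \<in> B}"
    and f: "\<And>B y. \<lbrakk>B \<in> C; y \<in> B - {x}\<rbrakk> \<Longrightarrow> sum f (branch B y) = s"
  shows "sum f (\<Union>B\<in>C. \<Union>y\<in>B - {x}. branch B y) = card C * (n * s)"
proof -
  have fC: "finite C" using finite_subset[OF C] fin_BB by auto
  have CB: "B \<in> BB" "x \<in> B" if "B \<in> C" for B using C that by auto
  have "sum f (\<Union>B\<in>C. \<Union>y\<in>B - {x}. branch B y) = (\<Sum>B\<in>C. sum f (\<Union>y\<in>B - {x}. branch B y))"
  proof (rule sum.UNION_disjoint[OF fC])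
    show "\<forall>B\<in>C. finite (\<Union>y\<in>B - {x}. branch B y)"
      using CB fin_block fin_branch by auto
    show "\<forall>B\<in>C. \<forall>B'\<in>C. B \<noteq> B' \<longrightarrow>
        (\<Union>y\<in>B - {x}. branch B y) \<inter> (\<Union>y\<in>B' - {x}. branch B' y) = {}"
    proof (intro ballI impI)
      fix B B' assume a: "B \<in> C" "B' \<in> C" "B \<noteq> B'"
      have "branch B y \<inter> branch B' y' = {}" if "y \<in> B - {x}" "y' \<in> B' - {x}" for y y'
        using branches_disjoint[of B x y B' y'] a CB that by auto
      then show "(\<Union>y\<in>B - {x}. branch B y) \<inter> (\<Union>y\<in>B' - {x}. branch B' y) = {}" by blast
    qed
  qed
  also have "\<dots> = (\<Sum>B\<in>C. n * s)"
  proof (rule sum.cong[OF refl])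
    fix B assume B: "B \<in> C"
    have "sum f (\<Union>y\<in>B - {x}. branch B y) = (\<Sum>y\<in>B - {x}. sum f (branch B y))"
      using CB[OF B] fin_block fin_branch
      by (intro sum.UNION_disjoint) (auto simp: branch_def)
    also have "\<dots> = card (B - {x}) * s" using f B by simp
    also have "card (B - {x}) = n" using CB[OF B] block_card by simp
    finally show "sum f (\<Union>y\<in>B - {x}. branch B y) = n * s" .
  qed
  finally show ?thesis by simp
qed

lemma sum_d_branch:
  assumes "B \<in> BB" "x \<in> B" "y \<in> B - {x}"
  shows "sum (d x) (branch B y) = sum (d y) (branch B y) + card (branch B y)"
proof -
  have "sum (d x) (branch B y) = (\<Sum>v\<in>branch B y. d y v + 1)"
    using assms d_branch by (intro sum.cong) auto
  then show ?thesis by (simp only: sum.distrib) simp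
qed

lemma ex_other_block:
  assumes "deg x \<noteq> 1" "B \<in> BB" "x \<in> B"
  obtains B' where "B' \<in> BB" "x \<in> B'" "B' \<noteq> B"
proof -
  have "{B' \<in> BB. x \<in> B'} \<noteq> {B}" using assms(1) unfolding deg_def by force
  then obtain B' where "B' \<in> {B' \<in> BB. x \<in> B'}" "B' \<noteq> B" using assms(2,3) by blast
  then show ?thesis using that by blast
qed

lemma deg_1_branch:
  assumes "deg x = 1" "B \<in> BB" "x \<in> B"
  shows "branch B x = {x}"
proof -
  obtain B0 where "{B' \<in> BB. x \<in> B'} = {B0}"
    using assms(1) unfolding deg_def by (elim card_1_singletonE)
  moreover have "B \<in> {B' \<in> BB. x \<in> B'}" using assms by simp
  ultimately have "{B' \<in> BB. x \<in> B'} = {B}" by simp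
  then have "branch B x - {x} = {}" using branch_minus_root[OF assms(2,3)] by auto
  then show ?thesis using root_in_branch[OF assms(2,3)] by auto
qed

text \<open>Any vertex of the branch farthest from its root will do.\<close>

lemma ex_end_in_branch:
  assumes B: "B \<in> BB" "x \<in> B"
  obtains e where "e \<in> branch B x" "deg e = 1"
proof -
  have "\<exists>e\<in>branch B x. \<forall>v\<in>branch B x. d x v \<le> d x e"
  proof -
    let ?m = "Max (d x ` branch B x)"
    have ne: "branch B x \<noteq> {}" using root_in_branch[OF B] by auto
    have "?m \<in> d x ` branch B x" using fin_branch ne by (intro Max_in) auto
    then obtain e where "e \<in> branch B x" "d x e = ?m" by auto
    then show ?thesis using fin_branch by (intro bexI[of _ e]) auto
  qed
  then obtain e where e: "e \<in> branch B x" and mx: "\<And>v. v \<in> branch B x \<Longrightarrow> d x v \<le> d x e" by auto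
  have eV: "e \<in> V" and ge: "gate B e = x" using e by (auto simp: branch_def)
  have xV: "x \<in> V" using B block_sub by auto
  have "deg e = 1"
  proof (rule ccontr)
    assume ne: "deg e \<noteq> 1"
    \<comment> \<open>If \<open>e\<close> is in no block or several, then some block at it other
      than \<open>B\<close> faces away from \<open>x\<close>, or none exists to be left; a further
      vertex of such a block stays in the branch but lies deeper.\<close>
    have "\<exists>B1\<in>BB. e \<in> B1 \<and> gate B1 x = e \<and> B1 \<noteq> B"
    proof (cases "e = x")
      case True
      then show ?thesis using ex_other_block[OF ne] B gate_id by metis
    next
      case False
      then have "e \<notin> B" using ge gate_id B by auto
      obtain B2 where B2: "B2 \<in> BB" "e \<in> B2" "gate B2 x \<noteq> e"
        using ex_leaving_block[OF eV xV False] .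
      obtain B1 where "B1 \<in> BB" "e \<in> B1" "B1 \<noteq> B2" using ex_other_block[OF ne B2(1,2)] .
      then show ?thesis using gate_other_block[OF B2(1,2) _ _ _ xV B2(3)] \<open>e \<notin> B\<close> by metis
    qed
    then obtain B1 where B1: "B1 \<in> BB" "e \<in> B1" "gate B1 x = e" "B1 \<noteq> B" by auto
    have "card B1 \<noteq> 1" using block_card[OF B1(1)] n_pos by simp
    then have "B1 \<noteq> {e}" by auto
    then obtain z where z: "z \<in> B1" "z \<noteq> e" using B1 by auto
    have zV: "z \<in> V" using z B1 block_sub by auto
    have "gate B z = x" using gate_block[OF B(1) B1(1) B1(4)[symmetric] z(1) B1(2)] ge by simp
    then have "z \<in> branch B x" using zV by (auto simp: branch_def)
    moreover have "d z x = 1 + d e x" using d_block[OF B1(1) z(1) xV] B1(3) z by auto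
    ultimately show False using mx[of z] d_sym[of z x] d_sym[of e x] by simp
  qed
  then show ?thesis using that e by blast
qed

end

section \<open>Branches of regular clique trees\<close>

locale regular_clique_tree = clique_tree +
  fixes k :: nat
  assumes deg_cases: "v \<in> V \<Longrightarrow> deg v = 1 \<or> deg v = Suc k"
begin

text \<open>A root that is an end is an end at depth 0. So for positive \<open>h\<close> the root
  has \<open>k\<close> further blocks with \<open>n\<close> new vertices each, and in all these
  \<open>k * n\<close> subbranches the ends are one level less deep.\<close>

lemma uniform_branch:
  assumes "B \<in> BB" "x \<in> B" "\<And>e. \<lbrakk>e \<in> branch B x; deg e = 1\<rbrakk> \<Longrightarrow> d x e = h"
  shows "card (branch B x) = branch_card (k * n) h \<and> sum (d x) (branch B x) = branch_weight (k * n) h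
    \<and> (\<forall>v\<in>branch B x. d x v \<le> h)"
  using assms
proof (induction h arbitrary: B x)
  case 0
  have xV: "x \<in> V" using 0 block_sub by auto
  obtain e where e: "e \<in> branch B x" "deg e = 1" using ex_end_in_branch[OF 0(1,2)] .
  have "d x e = 0" using 0(3) e by auto
  then have "x = e" using d_eq_0[OF xV] e branch_V by blast
  then have "branch B x = {x}" using deg_1_branch e 0 by auto
  then show ?case by simp
next
  case (Suc h)
  have xV: "x \<in> V" using Suc.prems block_sub by auto
  have "deg x \<noteq> 1" using Suc.prems(3)[of x] root_in_branch Suc.prems by auto
  then have dx: "deg x = Suc k" using deg_cases[OF xV] by auto
  define C where "C = {B'\<in>BB. x \<in> B'} - {B}"
  have C: "C \<subseteq> {B'\<in>BB. x \<in> B'}" by (auto simp: C_def)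
  have cC: "card C = k"
    using dx Suc.prems unfolding C_def deg_def by (subst card_Diff_singleton) auto
  have br: "branch B x - {x} = (\<Union>B'\<in>C. \<Union>y\<in>B' - {x}. branch B' y)"
    unfolding C_def by (rule branch_minus_root[OF Suc.prems(1,2)])
  have xin: "x \<in> branch B x" using root_in_branch Suc.prems by auto
  have sub: "card (branch B' y) = branch_card (k * n) h \<and> sum (d y) (branch B' y) = branch_weight (k * n) h
    \<and> (\<forall>v\<in>branch B' y. d y v \<le> h)" if "B' \<in> C" "y \<in> B' - {x}" for B' y
  proof (rule Suc.IH)
    show "B' \<in> BB" "y \<in> B'" using that C_def by auto
    fix e assume e: "e \<in> branch B' y" "deg e = 1"
    then have "e \<in> branch B x" using br that by blast
    then have "d x e = Suc h" using Suc.prems(3) e by auto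
    then show "d y e = h" using d_branch[of B' x y e] e that C_def by auto
  qed
  have "sum (\<lambda>_. 1) (branch B x - {x}) = card C * (n * branch_card (k * n) h)"
    unfolding br by (rule sum_branches[OF C]) (use sub in auto)
  then have 1: "card (branch B x) = branch_card (k * n) (Suc h)"
    using card.remove[OF fin_branch xin] cC by (simp add: mult.assoc)
  have "sum (d x) (branch B x - {x}) = card C * (n * (branch_weight (k * n) h + branch_card (k * n) h))"
    unfolding br
  proof (rule sum_branches[OF C])
    fix B' y assume a: "B' \<in> C" "y \<in> B' - {x}"
    then show "sum (d x) (branch B' y) = branch_weight (k * n) h + branch_card (k * n) h"
      using sum_d_branch[of B' x y] sub[OF a] C_def by auto
  qed
  moreover have "sum (d x) (branch B x) = d x x + sum (d x) (branch B x - {x})"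
    by (rule sum.remove[OF fin_branch xin])
  ultimately have 2: "sum (d x) (branch B x) = branch_weight (k * n) (Suc h)"
    using cC by (simp add: mult.assoc)
  have "d x v \<le> Suc h" if "v \<in> branch B x" for v
  proof (cases "v = x")
    case False
    then have "v \<in> (\<Union>B'\<in>C. \<Union>y\<in>B' - {x}. branch B' y)"
      unfolding br[symmetric] using that by simp
    then obtain B' y where a: "B' \<in> C" "y \<in> B' - {x}" "v \<in> branch B' y" by (elim UN_E)
    then show ?thesis using sub[OF a(1,2)] d_branch[of B' x y v] C_def by auto
  qed simp
  then show ?case using 1 2 by blast
qed

end

lemma mod_shift_neq:
  fixes i s N :: nat
  assumes "0 < s" "s < N"
  shows "i mod N \<noteq> (i + s) mod N"
proof
  assume "i mod N = (i + s) mod N"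
  then have "N dvd (i + s) - i" by (metis le_add1 mod_eq_dvd_iff_nat)
  then show False using assms by (auto dest: dvd_imp_le)
qed

text \<open>A linear bound is enough: it only has to beat the multiples of the height demanded by
  \<open>coloring_from_ordering\<close>.\<close>

lemma branch_card_ge: "x \<ge> 2 \<Longrightarrow> 2 * h + 1 \<le> branch_card x h"
proof (induction h)
  case (Suc h)
  have "2 * (2 * h + 1) \<le> x * branch_card x h" using Suc by (intro mult_le_mono) auto
  then show ?case by simp
qed simp

section \<open>Symmetric clique trees: end vertices and diameter\<close>

locale symmetric_clique_tree = regular_clique_tree +
  fixes dm :: nat
  assumes k_pos: "k \<ge> 1" and n_ge: "n \<ge> 2"
    and diam_le: "\<lbrakk>u \<in> V; v \<in> V\<rbrakk> \<Longrightarrow> d u v \<le> dm"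
    and diam_ex: "\<exists>u\<in>V. \<exists>v\<in>V. d u v = dm"
    and ends_ecc: "\<lbrakk>u \<in> V; v \<in> V; deg u = 1; deg v = 1\<rbrakk> \<Longrightarrow> Max (d u ` V) = Max (d v ` V)"
begin

text \<open>Longest paths are already replaced by \<open>n * d u v\<close>;
  \<open>longest_path_length_eq\<close> justifies this for block graphs.\<close>

definition ham :: "('a \<Rightarrow> nat) \<Rightarrow> bool" where
  "ham c \<longleftrightarrow> (\<forall>u\<in>V. \<forall>v\<in>V. u \<noteq> v \<longrightarrow>
    int (card V) - 1 \<le> int (n * d u v) + \<bar>int (c u) - int (c v)\<bar>)"

text \<open>Integer valued, because the formulas to be proved contain subtractions that must not be
  truncated.\<close>

definition min_span :: "int \<Rightarrow> bool" where
  "min_span s \<longleftrightarrow> (\<exists>c. ham c \<and> int (Max (c ` V)) = s) \<and> (\<forall>c. ham c \<longrightarrow> s \<le> int (Max (c ` V)))"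

lemma kn_ge: "k * n \<ge> 2"
proof -
  have "1 * 2 \<le> k * n" using k_pos n_ge by (intro mult_le_mono)
  then show ?thesis by simp
qed

text \<open>An end of a diametral pair is an end vertex, as otherwise one could go on into another block.\<close>

lemma end_ecc:
  assumes e: "e \<in> V" "deg e = 1"
  obtains y where "y \<in> V" "d e y = dm"
proof -
  obtain u v where uv: "u \<in> V" "v \<in> V" "d u v = dm" using diam_ex by auto
  have mx: "Max (d x ` V) \<in> d x ` V" if "x \<in> V" for x using that fin_V by (intro Max_in) auto
  have "deg u = 1"
  proof (rule ccontr)
    assume ne: "deg u \<noteq> 1"
    have "\<exists>B\<in>BB. u \<in> B \<and> gate B v = u"
    proof (cases "u = v")
      case True
      have "deg u \<noteq> 0" using deg_cases[OF uv(1)] by auto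
      then have "{B \<in> BB. u \<in> B} \<noteq> {}" unfolding deg_def by (metis card.empty)
      then show ?thesis using True gate_id by auto
    next
      case False
      then obtain B2 where B2: "B2 \<in> BB" "u \<in> B2" "gate B2 v \<noteq> u"
        using ex_leaving_block uv by metis
      obtain B1 where B1: "B1 \<in> BB" "u \<in> B1" "B1 \<noteq> B2" using ex_other_block[OF ne B2(1,2)] .
      then show ?thesis using gate_other_block[OF B2(1,2) B1(1,2) B1(3)[symmetric] uv(2) B2(3)] by blast
    qed
    then obtain B where B: "B \<in> BB" "u \<in> B" "gate B v = u" by auto
    have "card B \<noteq> 1" using block_card[OF B(1)] n_pos by simp
    then have "B \<noteq> {u}" by auto
    then obtain z where z: "z \<in> B" "z \<noteq> u" using B by auto
    then have "d z v = 1 + d u v" using d_block[OF B(1) z(1) uv(2)] B by auto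
    moreover have "z \<in> V" using z B block_sub by auto
    ultimately show False using diam_le[of z v] uv by simp
  qed
  then have "Max (d e ` V) = Max (d u ` V)" by (rule ends_ecc[OF e(1) uv(1) e(2)])
  moreover have "Max (d u ` V) = dm"
    using uv fin_V diam_le by (intro Max_eqI) auto
  ultimately have "dm \<in> d e ` V" using mx[OF e(1)] by simp
  then obtain y where "y \<in> V" "d e y = dm" by auto
  then show ?thesis by (rule that)
qed

lemma d_through:
  assumes B: "B \<in> BB" "w \<in> B" and x: "x \<in> V" "gate B x \<noteq> w" and y: "y \<in> V" "gate B y = w"
  shows "d x y = d w x + d w y"
  using d_gates[OF B(1) x(1) y(1)] d_block[OF B x] x y d_sym[of x "gate B x"] by simp

section \<open>Even diameter\<close>

text \<open>The center is the midpoint of a diametral pair. It separates every vertex from one of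
  the two ends, which bounds the level by half the diameter; for end vertices the eccentricity then
  forces equality.\<close>

lemma even_center:
  assumes dm: "dm = 2 * Suc h"
  obtains w where "w \<in> V" "deg w = Suc k"
    "\<And>B y. \<lbrakk>B \<in> BB; w \<in> B; y \<in> B - {w}\<rbrakk> \<Longrightarrow> card (branch B y) = branch_card (k * n) h
      \<and> sum (d y) (branch B y) = branch_weight (k * n) h"
    "\<And>x. x \<in> V \<Longrightarrow> d w x \<le> Suc h"
proof -
  obtain u v where uv: "u \<in> V" "v \<in> V" "d u v = Suc h + Suc h" using diam_ex dm by auto
  obtain w where w: "w \<in> V" "d u w = Suc h" "d w v = Suc h" by (rule geodesic_split[OF uv])
  have wu: "d w u = Suc h" using w(2) d_sym by simp
  then have "w \<noteq> u" by auto
  then obtain B where B: "B \<in> BB" "w \<in> B" "gate B u \<noteq> w" using ex_leaving_block w uv by metis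
  \<comment> \<open>Otherwise a path could bypass \<open>w\<close> inside \<open>B\<close>, and
    \<open>u\<close> and \<open>v\<close> would be at distance at most
    \<open>h + 1 + h\<close>.\<close>
  have gv: "gate B v = w"
  proof (rule ccontr)
    assume g: "gate B v \<noteq> w"
    have "d u v \<le> d (gate B u) u + d (gate B v) v + 1" by (rule d_le_gates[OF B(1) uv(1,2)])
    moreover have "d w u = 1 + d (gate B u) u" using d_block B uv by auto
    moreover have "d w v = 1 + d (gate B v) v" using d_block B uv g by auto
    ultimately show False using uv w wu by simp
  qed
  have radius: "d w x \<le> Suc h" if x: "x \<in> V" for x
  proof (cases "gate B x = w")
    case True
    then have "d u x = d w u + d w x" using d_through[OF B(1,2) uv(1) B(3) x] by simp
    then show ?thesis using diam_le[OF uv(1) x] wu dm by simp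
  next
    case False
    then have "d x v = d w x + d w v" using d_through[OF B(1,2) x _ uv(2) gv] by simp
    then show ?thesis using diam_le[OF x uv(2)] w dm by simp
  qed
  have ends: "d w e = Suc h" if e: "e \<in> V" "deg e = 1" for e
  proof -
    obtain y where y: "y \<in> V" "d e y = dm" using end_ecc[OF e] .
    have "d e y \<le> d e w + d w y" using d_triangle e w y by auto
    then show ?thesis using radius[OF e(1)] radius[OF y(1)] y dm d_sym[of e w] by simp
  qed
  have "deg w \<noteq> 1" using ends[OF w(1)] by auto
  then have dw: "deg w = Suc k" using deg_cases w by auto
  show ?thesis
  proof (rule that[OF w(1) dw _ radius])
    fix B y assume a: "B \<in> BB" "w \<in> B" "y \<in> B - {w}"
    have "d y e = h" if "e \<in> branch B y" "deg e = 1" for e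
      using ends[of e] d_branch[of B w y e] a that branch_V by auto
    then show "card (branch B y) = branch_card (k * n) h \<and> sum (d y) (branch B y) = branch_weight (k * n) h"
      using uniform_branch[of B y h] a by auto
  qed
qed

lemma d_distinct_blocks:
  assumes "B1 \<in> BB" "w \<in> B1" "y1 \<in> B1 - {w}" "x1 \<in> branch B1 y1"
    "B2 \<in> BB" "w \<in> B2" "y2 \<in> B2 - {w}" "x2 \<in> branch B2 y2" "B1 \<noteq> B2"
  shows "d x1 x2 = d w x1 + d w x2"
proof (rule d_through[of B1])
  show "gate B1 x2 = w"
    using gate_other_block[of B2 w B1 x2] assms by (auto simp: branch_def)
qed (use assms in \<open>auto simp: branch_def\<close>)

text \<open>The worst case is a common block at \<open>w\<close>: the edge between the two branch
  roots bypasses \<open>w\<close> and saves exactly one.\<close>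

lemma d_distinct_branches:
  assumes "B1 \<in> BB" "w \<in> B1" "y1 \<in> B1 - {w}" "x1 \<in> branch B1 y1"
    "B2 \<in> BB" "w \<in> B2" "y2 \<in> B2 - {w}" "x2 \<in> branch B2 y2" "(B1, y1) \<noteq> (B2, y2)"
  shows "d w x1 + d w x2 \<le> Suc (d x1 x2)"
proof (cases "B1 = B2")
  case True
  have "d x1 x2 = d x1 y1 + 1 + d y2 x2"
    using d_gates[of B1 x1 x2] assms True by (auto simp: branch_def)
  then show ?thesis
    using d_branch[of B1 w y1 x1] d_branch[of B1 w y2 x2] assms True d_sym[of x1 y1] by simp
next
  case False
  then show ?thesis using d_distinct_blocks[OF assms(1-8)] by simp
qed

text \<open>\<open>m\<close> is the order minus one and \<open>W\<close> the sum of all levels; the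
  value is the general bound for \<open>e = 0\<close> and \<open>q = 1\<close>.\<close>

theorem min_span_even:
  assumes dm: "dm = 2 * Suc h" and h: "h \<ge> 1"
    and m: "m = Suc k * (n * branch_card (k * n) h)"
    and W: "W = Suc k * (n * (branch_weight (k * n) h + branch_card (k * n) h))"
  shows "min_span (int m * int m - int n * (2 * int W - 1))"
proof -
  obtain w where w: "w \<in> V" "deg w = Suc k"
    and br: "\<And>B y. \<lbrakk>B \<in> BB; w \<in> B; y \<in> B - {w}\<rbrakk> \<Longrightarrow> card (branch B y) = branch_card (k * n) h
      \<and> sum (d y) (branch B y) = branch_weight (k * n) h"
    and radius: "\<And>x. x \<in> V \<Longrightarrow> d w x \<le> Suc h"
    using even_center[OF dm] by blast
  define b where "b = branch_card (k * n) h"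
  define C where "C = {B \<in> BB. w \<in> B}"
  have CB: "B \<in> BB" "w \<in> B" if "B \<in> C" for B using that by (auto simp: C_def)
  have cC: "card C = Suc k" "finite C" using w fin_BB by (auto simp: C_def deg_def)
  have Vw: "V - {w} = (\<Union>B\<in>C. \<Union>y\<in>B - {w}. branch B y)"
    using verts_minus_center[OF w(1)] by (simp add: C_def)
  have Csub: "C \<subseteq> {B \<in> BB. w \<in> B}" by (simp add: C_def)
  have bC: "card (branch B y) = b" "sum (d y) (branch B y) = branch_weight (k * n) h"
    if "B \<in> C" "y \<in> B - {w}" for B y
    using br[OF CB[OF that(1)] that(2)] by (simp_all add: b_def)
  have "sum (\<lambda>_. 1) (V - {w}) = card C * (n * b)"
    unfolding Vw by (rule sum_branches[OF Csub]) (simp add: bC(1))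
  then have cV1: "card (V - {w}) = m" using cC m b_def by simp
  then have cV: "card V = Suc m" using card.remove[OF fin_V w(1)] by simp
  have "sum (d w) (V - {w}) = card C * (n * (branch_weight (k * n) h + b))"
    unfolding Vw
    by (rule sum_branches[OF Csub]) (simp only: sum_d_branch[OF CB] bC)
  then have sW: "sum (d w) V = W" using sum.remove[OF fin_V w(1), of "d w"] cC W b_def by simp
  have bge: "2 * h + 1 \<le> b" unfolding b_def by (rule branch_card_ge[OF kn_ge])
  have mge: "n * (2 * b) \<le> m"
    unfolding m b_def[symmetric] using mult_le_mono1[of 2 "Suc k" "n * b"] k_pos by (simp add: ac_simps)
  have pos: "1 \<le> d u v" if "u \<in> V" "v \<in> V" "u \<noteq> v" for u v
    using d_eq_0[OF that(1,2)] that(3) by (simp add: Suc_leI)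
  have m_pos: "m \<ge> 1"
  proof -
    have "1 * 1 \<le> n * (2 * b)" using n_pos bge by (intro mult_le_mono) auto
    then show ?thesis using mge by linarith
  qed
  have lower: "int m * int m - int n * (2 * int W - 1) \<le> int (Max (c ` V))" if c: "ham c" for c
  proof -
    have "int m * int m - int n * (2 * int (sum (d w) V) + 0 * int m - 1) \<le> int (Max (c ` V))"
    proof (rule coloring_lower_bound[OF fin_V cV m_pos, where D = "\<lambda>u v. n * d u v"])
      fix u v assume uv: "u \<in> V" "v \<in> V" "u \<noteq> v"
      have "n * d u v \<le> n * (d w u + d w v)"
        using d_triangle[OF uv(1) w(1) uv(2)] d_sym[of u w] by (intro mult_le_mono2) simp
      then show "int (n * d u v) \<le> int n * (int (d w u) + int (d w v) + 0)"
        by (simp flip: of_nat_add of_nat_mult)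
      \<comment> \<open>Only the center has level 0, so the levels of two distinct vertices add up
        to at least 1.\<close>
      have "u \<noteq> w \<or> v \<noteq> w" using uv by auto
      then show "1 \<le> int (d w u) + int (d w v)" using pos[OF w(1) uv(1)] pos[OF w(1) uv(2)] by auto
      show "int m \<le> int (n * d u v) + \<bar>int (c u) - int (c v)\<bar>"
        using c uv cV unfolding ham_def by force
    qed simp
    then show ?thesis using sW by simp
  qed

  obtain \<beta> where \<beta>: "bij_betw \<beta> {..<Suc k} C"
    using ex_bij_betw_nat_finite[OF cC(2)] cC(1) by (auto simp: atLeast0LessThan)
  then have \<beta>C: "\<beta> j \<in> C" if "j < Suc k" for j using that by (auto simp: bij_betw_def)
  have \<beta>ne: "\<beta> i \<noteq> \<beta> j" if "i < Suc k" "j < Suc k" "i \<noteq> j" for i j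
    using \<beta> that by (auto simp: bij_betw_def inj_on_def)
  \<comment> \<open>A branch is labelled by a block at \<open>w\<close> and a further vertex of it.
    One round robin over the blocks orders the labels, a second one over the branches orders the
    vertices.\<close>
  define P where "P j = {\<beta> j} \<times> (\<beta> j - {w})" for j
  have P: "finite (P j) \<and> card (P j) = n" if "j < Suc k" for j
    using CB[OF \<beta>C[OF that]] fin_block block_card by (simp add: P_def card_cartesian_product_singleton)
  have Pdis: "P i \<inter> P j = {}" if "i < Suc k" "j < Suc k" "i \<noteq> j" for i j
    using \<beta>ne[OF that] by (auto simp: P_def)
  have Pne: "P j \<noteq> {}" if "j < Suc k" for j using P[OF that] n_pos by auto
  obtain p0 pk where p0: "p0 \<in> P 0" "pk \<in> P (Suc k - 1)" using Pne[of 0] Pne[of k] by auto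
  define N where "N = Suc k * n"
  obtain T where T: "bij_betw T {..<N} (\<Union>j<Suc k. P j)"
    and TP: "\<And>i. i < N \<Longrightarrow> T i \<in> P (i mod Suc k)"
    unfolding N_def using ex_round_robin[OF P Pdis _ p0] k_pos by force
  \<comment> \<open>A shift by two must reach another branch, which takes more than two of
    them.\<close>
  have N: "N \<ge> 4" unfolding N_def using mult_le_mono[of 2 "Suc k" 2 n] k_pos n_ge by simp
  define Bl where "Bl j = fst (T j)" for j
  define y where "y j = snd (T j)" for j
  have Bl: "Bl j = \<beta> (j mod Suc k)" "y j \<in> Bl j - {w}" if "j < N" for j
    using TP[OF that] by (auto simp: P_def Bl_def y_def)
  have BlB: "Bl j \<in> BB" "w \<in> Bl j" if "j < N" for j
    using CB[OF \<beta>C[of "j mod Suc k"]] Bl[OF that] by auto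
  have Tne: "(Bl i, y i) \<noteq> (Bl j, y j)" if "i < N" "j < N" "i \<noteq> j" for i j
    using T that by (auto simp: Bl_def y_def bij_betw_def inj_on_def prod_eq_iff)
  define S where "S j = branch (Bl j) (y j)" for j
  have S: "finite (S j) \<and> card (S j) = b" if "j < N" for j
    using br[OF BlB[OF that] Bl(2)[OF that]] fin_branch by (simp add: S_def b_def)
  have Sdis: "S i \<inter> S j = {}" if "i < N" "j < N" "i \<noteq> j" for i j
    unfolding S_def by (rule branches_disjoint[of _ w]) (use BlB Bl(2) Tne that in auto)
  have yS: "y j \<in> S j" if "j < N" for j
    using root_in_branch BlB Bl(2) that by (auto simp: S_def)
  have y0: "y 0 \<in> S 0" and yN: "y (N - 1) \<in> S (N - 1)" using yS N by auto
  have US: "(\<Union>j<N. S j) = V - {w}"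
  proof -
    have flatten: "(\<Union>p\<in>(\<Union>B\<in>C. {B} \<times> X B). branch (fst p) (snd p)) = (\<Union>B\<in>C. \<Union>y\<in>X B. branch B y)"
      for X by force
    have "(\<Union>j<N. S j) = (\<Union>p\<in>T ` {..<N}. branch (fst p) (snd p))" by (auto simp: S_def Bl_def y_def)
    also have "T ` {..<N} = (\<Union>j<Suc k. P j)" using T by (auto simp: bij_betw_def)
    also have "\<dots> = (\<Union>B\<in>C. {B} \<times> (B - {w}))" using \<beta> by (auto simp: P_def bij_betw_def)
    also have "(\<Union>p\<in>\<dots>. branch (fst p) (snd p)) = V - {w}"
      unfolding Vw by (rule flatten)
    finally show ?thesis .
  qed
  have N2: "N \<ge> 2" using N by simp
  obtain F where F: "bij_betw F {..<N * b} (V - {w})" "\<And>i. i < N * b \<Longrightarrow> F i \<in> S (i mod N)"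
    "F 0 = y 0" "F (N * b - 1) = y (N - 1)"
    using ex_round_robin[OF S Sdis N2 y0 yN, unfolded US] by blast
  have Nb: "N * b = m" by (simp only: N_def m b_def mult.assoc)
  \<comment> \<open>The center comes first, with level 0, and the last vertex is a neighbour of it,
    with level 1; the ends thus contribute just \<open>q = 1\<close>.\<close>
  define f where "f i = (case i of 0 \<Rightarrow> w | Suc i' \<Rightarrow> F i')" for i
  have f0: "f 0 = w" and fS: "f (Suc i) = F i" for i by (auto simp: f_def)
  have f: "bij_betw f {..m} V"
  proof -
    have 1: "{..m} = insert 0 (Suc ` {..<m})" by (simp only: lessThan_Suc_eq_insert_0[symmetric] lessThan_Suc_atMost)
    have "bij_betw f (Suc ` {..<m}) (V - {w})"
      unfolding bij_betw_def
    proof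
      show "inj_on f (Suc ` {..<m})" using F(1) Nb by (auto simp: inj_on_def bij_betw_def fS)
      show "f ` Suc ` {..<m} = V - {w}" using F(1) Nb by (auto simp: bij_betw_def fS image_image)
    qed
    then have "bij_betw f (Suc ` {..<m} \<union> {0}) (V - {w} \<union> {w})"
      using notIn_Un_bij_betw[of 0 "Suc ` {..<m}" f "V - {w}"] f0 by auto
    moreover have "V - {w} \<union> {w} = V" using w by auto
    ultimately show ?thesis unfolding 1 by simp
  qed
  have md: "i mod N < N" for i using N by simp
  obtain c where c: "\<And>u v. \<lbrakk>u \<in> V; v \<in> V; u \<noteq> v\<rbrakk> \<Longrightarrow> int m \<le> int (n * d u v) + \<bar>int (c u) - int (c v)\<bar>"
    and cmax: "int (Max (c ` V)) = int m * int m - int n * (2 * int (sum (d w) V) + 0 * int m - int (d w (f 0)) - int (d w (f m)))"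
  proof (rule coloring_from_ordering[OF f, where N = "int n" and e = 0 and L = "d w" and D = "\<lambda>u v. n * d u v" and R = "Suc h"])
    show "n * d u v = n * d v u" for u v using d_sym by simp
    fix i
    assume i: "i < m"
    have "d w (f i) + d w (f (Suc i)) \<le> d (f i) (f (Suc i))"
    proof (cases i)
      case 0
      then show ?thesis using f0 by simp
    next
      case (Suc i')
      let ?j = "i' mod N" and ?j' = "Suc i' mod N"
      have Fi: "F i' \<in> S ?j" "F (Suc i') \<in> S ?j'" using F(2)[of i'] F(2)[of "Suc i'"] i Suc Nb by auto
      \<comment> \<open>Since \<open>Suc k\<close> divides \<open>N\<close>, the alternation of
        blocks persists when the cycle of branches starts over.\<close>
      have dv: "Suc k dvd N" unfolding N_def by (rule dvd_triv_left)
      have "Bl ?j = \<beta> (i' mod Suc k)" "Bl ?j' = \<beta> (Suc i' mod Suc k)"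
        using Bl(1)[OF md] mod_mod_cancel[OF dv] by auto
      moreover have "i' mod Suc k \<noteq> Suc i' mod Suc k" using mod_shift_neq[of 1 "Suc k" i'] k_pos by simp
      ultimately have "Bl ?j \<noteq> Bl ?j'" using \<beta>ne[of "i' mod Suc k" "Suc i' mod Suc k"] by simp
      then have "d (F i') (F (Suc i')) = d w (F i') + d w (F (Suc i'))"
        using d_distinct_blocks[OF BlB[OF md] Bl(2)[OF md] _ BlB[OF md] Bl(2)[OF md]] Fi
        unfolding S_def by blast
      then show ?thesis using Suc fS by simp
    qed
    then have "n * (d w (f i) + d w (f (Suc i))) \<le> n * d (f i) (f (Suc i))" by (intro mult_le_mono2)
    then show "int n * (int (d w (f i)) + int (d w (f (Suc i))) + 0) \<le> int (n * d (f i) (f (Suc i)))"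
      by (simp flip: of_nat_add of_nat_mult)
  next
    fix i
    assume i: "Suc i < m"
    have *: "d w (f i) + d w (f (Suc (Suc i))) \<le> Suc (d (f i) (f (Suc (Suc i))))"
    proof (cases i)
      case 0
      then show ?thesis using f0 by simp
    next
      case (Suc i')
      let ?j = "i' mod N" and ?j' = "Suc (Suc i') mod N"
      have Fi: "F i' \<in> S ?j" "F (Suc (Suc i')) \<in> S ?j'"
        using F(2)[of i'] F(2)[of "Suc (Suc i')"] i Suc Nb by auto
      \<comment> \<open>For \<open>k = 1\<close> both branches lie in the same block at
        \<open>w\<close>, so only their being different is available.\<close>
      have "?j \<noteq> ?j'" using mod_shift_neq[of 2 N i'] N by simp
      then have "d w (F i') + d w (F (Suc (Suc i'))) \<le> Suc (d (F i') (F (Suc (Suc i'))))"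
        using d_distinct_branches[OF BlB[OF md] Bl(2)[OF md] _ BlB[OF md] Bl(2)[OF md] _ Tne[OF md md]] Fi
        unfolding S_def by blast
      then show ?thesis using Suc fS by simp
    qed
    have "int n * (int (d w (f i)) + int (d w (f (Suc (Suc i)))) + 0 - 1) \<le> int n * int (d (f i) (f (Suc (Suc i))))"
      using * by (intro mult_left_mono) linarith+
    then show "int n * (int (d w (f i)) + int (d w (f (Suc (Suc i)))) + 0 - 1) \<le> int (n * d (f i) (f (Suc (Suc i))))"
      by simp
  next
    fix u v assume "u \<in> V" "v \<in> V" "u \<noteq> v"
    then have "n * 1 \<le> n * d u v" using pos by (intro mult_le_mono2)
    then show "int n \<le> int (n * d u v)" by (simp only: of_nat_le_iff mult_1_right)
  next
    \<comment> \<open>With \<open>b >= 2 * h + 1\<close> and \<open>m >= 2 * n * b\<close> the two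
      demands come down to \<open>2 * h + 3 <= 4 * h + 2\<close> and
      \<open>6 * h + 6 <= 8 * h + 5\<close>, true from \<open>h = 1\<close> on.\<close>
    have "n * (2 * Suc h + 1) \<le> n * (2 * b)" using bge h by (intro mult_le_mono2) presburger
    then have "n * (2 * Suc h + 1) \<le> m" using mge by linarith
    then have "int (n * (2 * Suc h + 1)) \<le> int m" by (simp only: of_nat_le_iff)
    then show "int n * (2 * int (Suc h) + 0 + 1) \<le> int m" by (simp add: algebra_simps)
    have "n * (3 * (2 * Suc h)) \<le> n * (4 * b + 1)" using bge h by (intro mult_le_mono2) presburger
    then have "n * (3 * (2 * Suc h)) \<le> 2 * m + n" using mge by (simp add: algebra_simps)
    then have "int (n * (3 * (2 * Suc h))) \<le> int (2 * m + n)" by (simp only: of_nat_le_iff)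
    then show "3 * (int n * (2 * int (Suc h) + 0)) \<le> 2 * int m + int n" by (simp add: algebra_simps)
  qed (use radius in auto)
  have "ham c" unfolding ham_def using c cV by auto
  moreover have "d w (f m) = 1"
  proof -
    have "f m = y (N - 1)" using fS[of "m - 1"] m_pos F(4) Nb by simp
    then show ?thesis using d_adj adjI BlB[of "N - 1"] Bl(2)[of "N - 1"] N by fastforce
  qed
  ultimately show ?thesis unfolding min_span_def using cmax lower sW f0 by auto
qed


section \<open>Odd diameter\<close>

text \<open>The central block is that of the middle edge of a diametral path. The gate of any vertex
  differs from one end of this edge, so its way to \<open>u\<close> or to \<open>v\<close> crosses
  \<open>C\<close>; this bounds its level.\<close>

lemma odd_center:
  assumes dm: "dm = Suc (2 * r)"
  obtains C where "C \<in> BB"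
    "\<And>y. y \<in> C \<Longrightarrow> card (branch C y) = branch_card (k * n) r
      \<and> sum (d y) (branch C y) = branch_weight (k * n) r"
    "\<And>x. x \<in> V \<Longrightarrow> d (gate C x) x \<le> r"
proof -
  obtain u v where uv: "u \<in> V" "v \<in> V" "d u v = r + Suc r" using diam_ex dm by auto
  obtain a where a: "a \<in> V" "d u a = r" "d a v = 1 + r"
    using geodesic_split[OF uv] by auto
  obtain b where b: "b \<in> V" "d a b = 1" "d b v = r" by (rule geodesic_split[OF a(1) uv(2) a(3)])
  have "(adj ^^ 1) a b" using d_walk[OF a(1) b(1)] b(2) by simp
  then have "adj a b" by (simp add: eq_OO)
  then obtain C where C: "C \<in> BB" "a \<in> C" "b \<in> C" "a \<noteq> b" unfolding adj_def by auto
  have au: "d a u = r" using a d_sym by simp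
  have bu: "d b u \<ge> r + 1"
    using d_triangle[OF uv(1) b(1) uv(2)] uv(3) b(3) d_sym[of b u] by simp
  \<comment> \<open>All vertices of \<open>C\<close> except the gate of \<open>u\<close> are equally
    far from \<open>u\<close>, whereas \<open>a\<close> is nearer than \<open>b\<close>.\<close>
  have gu: "gate C u = a"
  proof (rule ccontr)
    assume ne: "gate C u \<noteq> a"
    have 1: "d a u = 1 + d (gate C u) u" by (rule d_block[OF C(1,2) uv(1) ne])
    show False
    proof (cases "gate C u = b")
      case True
      then show False using 1 au bu by simp
    next
      case False
      then have "d b u = 1 + d (gate C u) u" by (rule d_block[OF C(1,3) uv(1)])
      then show False using 1 au bu by simp
    qed
  qed
  have gv: "gate C v = b"
  proof (rule ccontr)
    assume ne: "gate C v \<noteq> b"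
    have 1: "d b v = 1 + d (gate C v) v" by (rule d_block[OF C(1,3) uv(2) ne])
    show False
    proof (cases "gate C v = a")
      case True
      then show False using 1 a b by simp
    next
      case False
      then have "d a v = 1 + d (gate C v) v" by (rule d_block[OF C(1,2) uv(2)])
      then show False using 1 a b by simp
    qed
  qed
  have radius: "d (gate C x) x \<le> r" if x: "x \<in> V" for x
  proof (cases "gate C x = a")
    case False
    then have "d x u = d x (gate C x) + 1 + d a u"
      using d_gates[OF C(1) x uv(1)] gu by simp
    then show ?thesis using diam_le[OF x uv(1)] au dm d_sym[of x "gate C x"] by simp
  next
    case True
    then have "d x v = d x (gate C x) + 1 + d b v"
      using d_gates[OF C(1) x uv(2)] gv C(4) by simp
    then show ?thesis using diam_le[OF x uv(2)] b dm d_sym[of x "gate C x"] by simp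
  qed
  have ends: "d (gate C e) e = r" if e: "e \<in> V" "deg e = 1" for e
  proof -
    obtain y where y: "y \<in> V" "d e y = dm" using end_ecc[OF e] .
    have "d e y \<le> d (gate C e) e + d (gate C y) y + 1" by (rule d_le_gates[OF C(1) e(1) y(1)])
    then show ?thesis using radius[OF e(1)] radius[OF y(1)] y dm by simp
  qed
  show ?thesis
  proof (rule that[OF C(1) _ radius])
    fix y assume y: "y \<in> C"
    have "d y e = r" if "e \<in> branch C y" "deg e = 1" for e
      using ends[of e] that by (auto simp: branch_def)
    then show "card (branch C y) = branch_card (k * n) r \<and> sum (d y) (branch C y) = branch_weight (k * n) r"
      using uniform_branch[OF C(1) y, of r] by auto
  qed
qed

text \<open>The general bound for \<open>e = 1\<close> and \<open>q = 0\<close>: the central block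
  offers two ends of level 0. There are at least three branches, so even vertices two steps apart
  are fully separated.\<close>

theorem min_span_odd:
  assumes dm: "dm = Suc (2 * Suc h)"
    and m: "Suc m = Suc n * branch_card (k * n) (Suc h)"
    and W: "W = Suc n * branch_weight (k * n) (Suc h)"
  shows "min_span (int m * int m - int n * (2 * int W + int m))"
proof -
  obtain C where C: "C \<in> BB"
    and br: "\<And>y. y \<in> C \<Longrightarrow> card (branch C y) = branch_card (k * n) (Suc h)
      \<and> sum (d y) (branch C y) = branch_weight (k * n) (Suc h)"
    and radius: "\<And>x. x \<in> V \<Longrightarrow> d (gate C x) x \<le> Suc h"
    using odd_center[OF dm] by blast
  define b where "b = branch_card (k * n) (Suc h)"
  define N where "N = Suc n"
  define L where "L v = d (gate C v) v" for v
  have fC: "finite C" and cC: "card C = N" using fin_block block_card C by (auto simp: N_def)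
  have V: "V = (\<Union>y\<in>C. branch C y)" using gate_in[OF C] by (auto simp: branch_def)
  have dis: "branch C y \<inter> branch C y' = {}" if "y \<noteq> y'" for y y' using that by (auto simp: branch_def)
  have sumV: "sum f V = N * s" if "\<And>y. y \<in> C \<Longrightarrow> sum f (branch C y) = s" for f :: "'a \<Rightarrow> nat" and s
  proof -
    have "sum f V = sum f (\<Union>y\<in>C. branch C y)" by (rule arg_cong[OF V])
    also have "\<dots> = (\<Sum>y\<in>C. sum f (branch C y))"
      by (rule sum.UNION_disjoint) (use fC fin_branch dis in auto)
    finally show ?thesis using that cC by simp
  qed
  have bC: "card (branch C y) = b" "sum (d y) (branch C y) = branch_weight (k * n) (Suc h)" if "y \<in> C" for y
    using br[OF that] by (simp_all add: b_def)
  have "sum (\<lambda>_. 1) V = N * b" by (rule sumV) (simp add: bC(1))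
  then have cV: "card V = Suc m" using m by (simp add: N_def b_def)
  have "sum L V = N * branch_weight (k * n) (Suc h)"
  proof (rule sumV)
    fix y assume y: "y \<in> C"
    have "sum L (branch C y) = sum (d y) (branch C y)"
      by (rule sum.cong) (auto simp: branch_def L_def)
    then show "sum L (branch C y) = branch_weight (k * n) (Suc h)" using bC(2)[OF y] by simp
  qed
  then have sW: "sum L V = W" by (simp add: W N_def)
  have Nb: "N * b = Suc m" using m by (simp add: N_def b_def)
  \<comment> \<open>Chosen so that \<open>m = n * (1 + t)\<close>; the numeric demands are compared
    after cancelling \<open>n\<close>.\<close>
  define t where "t = Suc n * (k * branch_card (k * n) h)"
  have mt: "m = n + n * t"
    using m unfolding t_def branch_card.simps by (simp add: algebra_simps)
  have tge: "3 * (2 * h + 1) \<le> t"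
  proof -
    have "3 * (1 * (2 * h + 1)) \<le> t"
      unfolding t_def using n_ge k_pos branch_card_ge[OF kn_ge, of h] by (intro mult_le_mono) auto
    then show ?thesis by simp
  qed
  have pos: "1 \<le> d u v" if "u \<in> V" "v \<in> V" "u \<noteq> v" for u v
    using d_eq_0[OF that(1,2)] that(3) by (simp add: Suc_leI)
  have m_pos: "m \<ge> 1" using mt n_pos by simp
  have d_L: "d x y = L x + L y + 1" if "x \<in> V" "y \<in> V" "gate C x \<noteq> gate C y" for x y
    using d_gates[OF C that] d_sym[of x "gate C x"] by (simp add: L_def)

  have lower: "int m * int m - int n * (2 * int W + int m) \<le> int (Max (c ` V))" if c: "ham c" for c
  proof -
    have "int m * int m - int n * (2 * int (sum L V) + 1 * int m - 0) \<le> int (Max (c ` V))"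
    proof (rule coloring_lower_bound[OF fin_V cV m_pos, where D = "\<lambda>u v. n * d u v"])
      fix u v assume uv: "u \<in> V" "v \<in> V" "u \<noteq> v"
      have "n * d u v \<le> n * (L u + L v + 1)"
        unfolding L_def by (intro mult_le_mono2 d_le_gates[OF C uv(1,2)])
      then have "int (n * d u v) \<le> int (n * (L u + L v + 1))" by (simp only: of_nat_le_iff)
      then show "int (n * d u v) \<le> int n * (int (L u) + int (L v) + 1)"
        by (simp only: of_nat_mult of_nat_add of_nat_1)
      show "int m \<le> int (n * d u v) + \<bar>int (c u) - int (c v)\<bar>"
        using c uv cV unfolding ham_def by force
    qed simp_all
    then show ?thesis using sW by simp
  qed

  obtain \<gamma> where \<gamma>: "bij_betw \<gamma> {..<N} C"
    using ex_bij_betw_nat_finite[OF fC] cC by (auto simp: atLeast0LessThan)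
  then have \<gamma>C: "\<gamma> j \<in> C" if "j < N" for j using that by (auto simp: bij_betw_def)
  have \<gamma>ne: "\<gamma> i \<noteq> \<gamma> j" if "i < N" "j < N" "i \<noteq> j" for i j
    using \<gamma> that by (auto simp: bij_betw_def inj_on_def)
  define S where "S j = branch C (\<gamma> j)" for j
  have S: "finite (S j) \<and> card (S j) = b" if "j < N" for j
    using bC(1)[OF \<gamma>C[OF that]] fin_branch by (simp add: S_def)
  have Sdis: "S i \<inter> S j = {}" if "i < N" "j < N" "i \<noteq> j" for i j
    unfolding S_def by (rule dis[OF \<gamma>ne[OF that]])
  have N: "N \<ge> 3" using n_ge by (simp add: N_def)
  have \<gamma>S: "\<gamma> j \<in> S j" if "j < N" for j
    unfolding S_def by (rule root_in_branch[OF C \<gamma>C[OF that]])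
  have S0: "\<gamma> 0 \<in> S 0" and SN: "\<gamma> (N - 1) \<in> S (N - 1)" using \<gamma>S N by auto
  have US: "(\<Union>j<N. S j) = V"
  proof -
    have "(\<Union>j<N. S j) = (\<Union>y\<in>\<gamma> ` {..<N}. branch C y)" by (simp add: S_def)
    also have "\<gamma> ` {..<N} = C" using \<gamma> by (simp add: bij_betw_def)
    finally show ?thesis by (simp only: V[symmetric])
  qed
  have N2: "N \<ge> 2" using N by simp
  obtain f where f0: "bij_betw f {..<N * b} V" "\<And>i. i < N * b \<Longrightarrow> f i \<in> S (i mod N)"
    "f 0 = \<gamma> 0" "f (N * b - 1) = \<gamma> (N - 1)"
    using ex_round_robin[OF S Sdis N2 S0 SN, unfolded US] by blast
  have f: "bij_betw f {..m} V" using f0(1) Nb by (simp add: lessThan_Suc_atMost)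
  have fS: "f i \<in> V" "gate C (f i) = \<gamma> (i mod N)" if "i \<le> m" for i
    using f0(2)[of i] that Nb by (auto simp: S_def branch_def)
  have md: "i mod N < N" for i using N by simp
  have step: "d (f i) (f (i + s)) = L (f i) + L (f (i + s)) + 1" if "0 < s" "s < N" "i + s \<le> m" for i s
  proof (rule d_L)
    have "\<gamma> (i mod N) \<noteq> \<gamma> ((i + s) mod N)"
      using \<gamma>ne[OF md md mod_shift_neq[OF that(1,2)]] .
    then show "gate C (f i) \<noteq> gate C (f (i + s))" using fS(2)[of i] fS(2)[of "i + s"] that by simp
  qed (use fS that in auto)
  obtain c where c: "\<And>u v. \<lbrakk>u \<in> V; v \<in> V; u \<noteq> v\<rbrakk> \<Longrightarrow> int m \<le> int (n * d u v) + \<bar>int (c u) - int (c v)\<bar>"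
    and cmax: "int (Max (c ` V)) = int m * int m - int n * (2 * int (sum L V) + 1 * int m - int (L (f 0)) - int (L (f m)))"
  proof (rule coloring_from_ordering[OF f, where N = "int n" and e = 1 and L = L and D = "\<lambda>u v. n * d u v" and R = "Suc h"])
    show "n * d u v = n * d v u" for u v using d_sym by simp
    fix i
    assume i: "i < m"
    show "int n * (int (L (f i)) + int (L (f (Suc i))) + 1) \<le> int (n * d (f i) (f (Suc i)))"
      using step[of 1 i] N i by (simp add: algebra_simps)
  next
    fix i
    assume i: "Suc i < m"
    have "d (f i) (f (Suc (Suc i))) = L (f i) + L (f (Suc (Suc i))) + 1"
      using step[of 2 i] N i by simp
    then show "int n * (int (L (f i)) + int (L (f (Suc (Suc i)))) + 1 - 1) \<le> int (n * d (f i) (f (Suc (Suc i))))"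
      by (simp add: algebra_simps)
  next
    fix u v assume "u \<in> V" "v \<in> V" "u \<noteq> v"
    then have "n * 1 \<le> n * d u v" using pos by (intro mult_le_mono2)
    then show "int n \<le> int (n * d u v)" by (simp only: of_nat_le_iff mult_1_right)
  next
    \<comment> \<open>As \<open>t >= 6 * h + 3\<close>, the two demands follow from
      \<open>2 * h + 4 <= 6 * h + 4\<close> and \<open>6 * h + 9 <= 12 * h + 9\<close>.\<close>
    have "n * (2 * Suc h + 2) \<le> n * (1 + t)" using tge by (intro mult_le_mono2) presburger
    then have "n * (2 * Suc h + 2) \<le> m" using mt by simp
    then have "int (n * (2 * Suc h + 2)) \<le> int m" by (simp only: of_nat_le_iff)
    then show "int n * (2 * int (Suc h) + 1 + 1) \<le> int m" by (simp add: algebra_simps)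
    have "n * (3 * (2 * Suc h + 1)) \<le> n * (2 * (1 + t) + 1)" using tge by (intro mult_le_mono2) presburger
    then have "n * (3 * (2 * Suc h + 1)) \<le> 2 * m + n" using mt by (simp add: algebra_simps)
    then have "int (n * (3 * (2 * Suc h + 1))) \<le> int (2 * m + n)" by (simp only: of_nat_le_iff)
    then show "3 * (int n * (2 * int (Suc h) + 1)) \<le> 2 * int m + int n" by (simp add: algebra_simps)
  qed (use radius in \<open>auto simp: L_def\<close>)
  have "ham c" unfolding ham_def using c cV by auto
  moreover have "L (f 0) = 0" "L (f m) = 0"
  proof -
    have L\<gamma>: "L (\<gamma> j) = 0" if "j < N" for j using gate_id[OF C \<gamma>C[OF that]] by (simp add: L_def)
    have "f m = \<gamma> (N - 1)" using f0(4) Nb by simp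
    then show "L (f 0) = 0" "L (f m) = 0" using L\<gamma>[of 0] L\<gamma>[of "N - 1"] N f0(3) by auto
  qed
  ultimately show ?thesis unfolding min_span_def using cmax lower sW by auto
qed

end

section \<open>Blocks of a graph\<close>

lemma SUP_ereal_Max:
  fixes f :: "'a \<Rightarrow> nat"
  assumes "finite A" "A \<noteq> {}"
  shows "(SUP x\<in>A. ereal (real (f x))) = ereal (real (Max (f ` A)))"
proof (rule antisym)
  show "(SUP x\<in>A. ereal (real (f x))) \<le> ereal (real (Max (f ` A)))"
    using assms by (intro SUP_least) auto
  have "Max (f ` A) \<in> f ` A" using assms by (intro Max_in) auto
  then obtain x where "x \<in> A" "f x = Max (f ` A)" by auto
  then show "ereal (real (Max (f ` A))) \<le> (SUP x\<in>A. ereal (real (f x)))"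
    by (intro SUP_upper2[of x]) auto
qed

lemma rtranclp_distinct_path:
  assumes "R\<^sup>*\<^sup>* x y"
  shows "\<exists>xs. xs \<noteq> [] \<and> hd xs = x \<and> last xs = y \<and> successively R xs \<and> distinct xs"
  using assms
proof (induction rule: converse_rtranclp_induct)
  case base
  then show ?case by (intro exI[of _ "[y]"]) auto
next
  case (step x z)
  then obtain xs where xs: "xs \<noteq> []" "hd xs = z" "last xs = y" "successively R xs" "distinct xs" by auto
  show ?case
  proof (cases "x \<in> set xs")
    case True
    then obtain as bs where ab: "xs = as @ x # bs" by (auto simp: in_set_conv_decomp)
    then show ?thesis using xs by (intro exI[of _ "x # bs"]) (auto simp: successively_append_iff)
  next
    case False
    then show ?thesis using xs step(1) by (intro exI[of _ "x # xs"]) (cases xs, auto)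
  qed
qed

context graph begin

abbreviation (input) nonseparable :: "('a, 'b) pre_digraph \<Rightarrow> bool" where
  "nonseparable H \<equiv> graph H \<and> connected H \<and> (\<forall>v. \<not> cut_vertex H v)"

text \<open>Take a nonseparable supergraph of \<open>H\<close> with the most vertices plus arcs.
  Arcs count too, since a proper supergraph may have the same vertices.\<close>

lemma ex_block_superset:
  assumes "subgraph H G" "nonseparable H"
  shows "\<exists>B\<in>blocks G. subgraph H B"
proof -
  let ?Q = "\<lambda>K. subgraph K G \<and> nonseparable K \<and> subgraph H K"
  let ?size = "\<lambda>K. card (verts K) + card (arcs K)"
  have "wf_digraph H" using assms by (auto simp: subgraph_def)
  then have "?Q H" using assms wf_digraph.subgraph_refl by auto
  moreover have "?size K \<le> card (verts G) + card (arcs G)" if "?Q K" for K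
    using that by (intro add_mono card_mono) auto
  ultimately obtain K where K: "?Q K" and mx: "\<And>K'. ?Q K' \<Longrightarrow> ?size K' \<le> ?size K"
    using ex_has_greatest_nat[of ?Q H ?size] by (metis (no_types, lifting) less_Suc_eq_le)
  have "K' = K" if K': "subgraph K K'" "subgraph K' G" "nonseparable K'" for K'
  proof -
    have "subgraph H K'" using subgraph_trans K K' by blast
    then have "?size K' \<le> ?size K" using mx K' by auto
    moreover have sub: "verts K \<subseteq> verts K'" "arcs K \<subseteq> arcs K'" using K' by auto
    moreover have fin: "finite (verts K')" "finite (arcs K')"
      using fin_digraph_subgraph[OF K'(2)] fin_digraph.finite_verts fin_digraph.finite_arcs by auto
    moreover have "card (verts K) \<le> card (verts K')" "card (arcs K) \<le> card (arcs K')"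
      using sub fin by (auto intro: card_mono)
    ultimately have "card (verts K) = card (verts K')" "card (arcs K) = card (arcs K')" by linarith+
    then have "verts K = verts K'" "arcs K = arcs K'" using card_subset_eq fin sub by metis+
    moreover have "compatible K' K" using K' by auto
    ultimately show "K' = K"
      by (auto simp: compatible_def intro: pre_digraph.equality)
  qed
  then have "K \<in> blocks G" using K unfolding blocks_def max_subgraph_def by blast
  then show ?thesis using K by blast
qed

lemma graph_induce:
  assumes "T \<subseteq> verts G"
  shows "graph (G \<restriction> T)"
proof -
  have ind: "induced_subgraph (G \<restriction> T) G" by (rule induced_induce[OF assms])
  show ?thesis
    using digraphI_induced[OF ind] induced_graph_imp_symmetric[OF sym_arcs ind] by (rule digraph.graphI)
qed

text \<open>The hypothesis on \<open>W\<close> bundles two facts: \<open>W = T\<close> gives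
  connectedness, \<open>W = T - {v}\<close> excludes \<open>v\<close> as a cut vertex.\<close>

lemma ex_block_vertex_set:
  assumes T: "T \<subseteq> verts G" "T \<noteq> {}"
    and conn: "\<And>W x y. \<lbrakk>W = T \<or> (\<exists>v. W = T - {v}); x \<in> W; y \<in> W\<rbrakk> \<Longrightarrow> reachable (G \<restriction> W) x y"
  shows "\<exists>B\<in>blocks G. T \<subseteq> verts B"
proof -
  interpret H: graph "G \<restriction> T" by (rule graph_induce[OF T(1)])
  have "connected (G \<restriction> T)"
    using conn[of T] T(2) H.reachable_mk_symmetricI by (intro H.connectedI) auto
  moreover have "\<not> cut_vertex (G \<restriction> T) v" for v
  proof
    assume "cut_vertex (G \<restriction> T) v"
    moreover have "pre_digraph.del_vert (G \<restriction> T) v = G \<restriction> (T - {v})"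
      by (auto simp: pre_digraph.del_vert_def induce_subgraph_def)
    ultimately show False using conn[of "T - {v}"] by (auto simp: cut_vertex_def)
  qed
  ultimately obtain B where "B \<in> blocks G" "subgraph (G \<restriction> T) B"
    using ex_block_superset[of "G \<restriction> T"] subgraph_induce_subgraphI[OF T(1)] H.graph_axioms by auto
  then show ?thesis using subgraph_imp_subverts[of "G \<restriction> T" B] by auto
qed

lemma dominates_induce:
  "\<lbrakk>dominates G x y; x \<in> W; y \<in> W\<rbrakk> \<Longrightarrow> dominates (G \<restriction> W) x y"
  by (auto simp: arcs_ends_def arc_to_ends_def)

lemma dominates_in_block:
  assumes "dominates G u v"
  shows "\<exists>B\<in>blocks G. u \<in> verts B \<and> v \<in> verts B"
proof -
  have "\<exists>B\<in>blocks G. {u, v} \<subseteq> verts B"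
  proof (rule ex_block_vertex_set)
    show "{u, v} \<subseteq> verts G" using adj_in_verts[OF assms] by auto
    fix W x y assume W: "W = {u, v} \<or> (\<exists>z. W = {u, v} - {z})" "x \<in> W" "y \<in> W"
    interpret H: wf_digraph "G \<restriction> W" by (rule wellformed_induce_subgraph)
    show "reachable (G \<restriction> W) x y"
    proof (cases "x = y")
      case False
      then have "dominates G x y" using W assms graph_symmetric[OF assms] by auto
      then show ?thesis using W dominates_induce by auto
    qed (use W in auto)
  qed simp
  then show ?thesis by auto
qed

lemma walk_reachable_induce:
  "\<lbrakk>xs \<noteq> []; successively (dominates G) xs; set xs \<subseteq> W\<rbrakk> \<Longrightarrow> reachable (G \<restriction> W) (hd xs) (last xs)"
proof (induction xs)
  case (Cons x xs)
  interpret H: wf_digraph "G \<restriction> W" by (rule wellformed_induce_subgraph)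
  show ?case
  proof (cases xs)
    case Nil
    then show ?thesis using Cons.prems by auto
  next
    case (Cons y ys)
    then have "dominates (G \<restriction> W) x y" "reachable (G \<restriction> W) y (last xs)"
      using Cons.prems Cons.IH dominates_induce by auto
    then show ?thesis using Cons H.adj_reachable_trans by auto
  qed
qed simp

text \<open>
  A clique together with a path joining two of its vertices cannot be separated: of every path
  vertex, the part of the path before or after it survives the deletion of another vertex.
\<close>

lemma clique_with_ear_in_block:
  assumes S: "S \<subseteq> verts G" "\<And>x y. \<lbrakk>x \<in> S; y \<in> S; x \<noteq> y\<rbrakk> \<Longrightarrow> dominates G x y"
    and xs: "xs \<noteq> []" "successively (dominates G) xs" "distinct xs" "set xs \<subseteq> verts G"
      "hd xs \<in> S" "last xs \<in> S"
  shows "\<exists>B\<in>blocks G. S \<union> set xs \<subseteq> verts B"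
proof (rule ex_block_vertex_set)
  show "S \<union> set xs \<subseteq> verts G" using S xs by auto
  show "S \<union> set xs \<noteq> {}" using xs by auto
  fix W x y assume W: "W = S \<union> set xs \<or> (\<exists>v. W = S \<union> set xs - {v})" "x \<in> W" "y \<in> W"
  have WV: "W \<subseteq> verts G" using W S xs by auto
  interpret H: graph "G \<restriction> W" by (rule graph_induce[OF WV])
  have to_S: "\<exists>s\<in>S \<inter> W. reachable (G \<restriction> W) z s" if z: "z \<in> W" for z
  proof (cases "z \<in> S")
    case True
    then show ?thesis using z by (intro bexI[of _ z]) auto
  next
    case False
    then have "z \<in> set xs" using z W by auto
    then obtain as bs where ab: "xs = as @ z # bs" by (auto simp: in_set_conv_decomp)
    \<comment> \<open>\<open>W\<close> lacks at most one vertex of the path, and without repetitions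
      this vertex is on one side of \<open>z\<close> only.\<close>
    have "set (as @ [z]) \<subseteq> W \<or> set (z # bs) \<subseteq> W" using W z xs(3) ab by auto
    then show ?thesis
    proof
      assume sub: "set (as @ [z]) \<subseteq> W"
      have "reachable (G \<restriction> W) (hd (as @ [z])) (last (as @ [z]))"
        using xs(2) ab by (intro walk_reachable_induce[OF _ _ sub]) (auto simp: successively_append_iff)
      moreover have "hd (as @ [z]) = hd xs" using ab by (cases as) auto
      ultimately have "reachable (G \<restriction> W) z (hd xs)" using H.symmetric_reachable' by simp
      then show ?thesis using xs(5) H.reachable_in_verts(2) by (intro bexI[of _ "hd xs"]) fastforce+
    next
      assume sub: "set (z # bs) \<subseteq> W"
      have "reachable (G \<restriction> W) (hd (z # bs)) (last (z # bs))"
        using xs(2) ab by (intro walk_reachable_induce[OF _ _ sub]) (auto simp: successively_append_iff)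
      then have "reachable (G \<restriction> W) z (last xs)" using ab by simp
      then show ?thesis using xs(6) H.reachable_in_verts(2) by (intro bexI[of _ "last xs"]) fastforce+
    qed
  qed
  obtain s where s: "s \<in> S" "s \<in> W" "reachable (G \<restriction> W) x s" using to_S[OF W(2)] by auto
  obtain t where t: "t \<in> S" "t \<in> W" "reachable (G \<restriction> W) y t" using to_S[OF W(3)] by auto
  have "reachable (G \<restriction> W) s t"
  proof (cases "s = t")
    case False
    then show ?thesis using S(2) s t dominates_induce by auto
  qed (use s in auto)
  then show "reachable (G \<restriction> W) x y"
    using s(3) H.symmetric_reachable'[OF t(3)] H.reachable_trans by blast
qed

lemma reachable_imp_rtranclp: "reachable G u v \<Longrightarrow> (dominates G)\<^sup>*\<^sup>* u v"
  using reachable_rtranclI[of G u v] by (simp add: rtranclp_rtrancl_eq)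

end

section \<open>Block graphs as clique trees\<close>

locale clique_block_graph = graph G for G :: "('a, 'b) pre_digraph" (structure) +
  fixes n :: nat
  assumes connected: "connected G"
    and complete_blocks: "B \<in> blocks G \<Longrightarrow> complete_digraph (Suc n) B"
    and n1: "n \<ge> 1"
begin

lemma block_subgraph: "B \<in> blocks G \<Longrightarrow> subgraph B G"
  unfolding blocks_def max_subgraph_def by simp

lemma block_dominates:
  assumes B: "B \<in> blocks G" and "x \<in> verts B" "y \<in> verts B" "x \<noteq> y"
  shows "dominates B x y" "dominates G x y"
proof -
  show "dominates B x y" using complete_blocks[OF B] assms(2-) by (auto simp: complete_digraph_def)
  then show "dominates G x y" using arcs_ends_mono[OF block_subgraph[OF B]] by auto
qed

text \<open>Complete blocks have all possible arcs and there are no parallel ones, so inclusion of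
  vertex sets carries over to arcs; maximality does the rest.\<close>

lemma block_eqI:
  assumes B: "B \<in> blocks G" "B' \<in> blocks G" and sub: "verts B \<subseteq> verts B'"
  shows "B = B'"
proof -
  have s: "subgraph B G" "subgraph B' G" using block_subgraph B by auto
  have c: "tail B = tail G" "head B = head G" "tail B' = tail G" "head B' = head G"
    using s by (auto simp: subgraph_def compatible_def)
  have "arcs B \<subseteq> arcs B'"
  proof
    fix e assume e: "e \<in> arcs B"
    then have eG: "e \<in> arcs G" using s by auto
    have "tail B e \<in> verts B" "head B e \<in> verts B" using s e by (auto simp: subgraph_def wf_digraph_def)
    then have "dominates B' (tail G e) (head G e)"
      using block_dominates(1)[OF B(2)] sub no_loops[OF eG] c by auto
    then obtain e' where e': "e' \<in> arcs B'" "tail B' e' = tail G e" "head B' e' = head G e" by auto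
    then have "e' = e" using no_multi_arcs[of e' e] eG s c by (auto simp: arc_to_ends_def)
    then show "e \<in> arcs B'" using e' by simp
  qed
  then have "subgraph B B'" using s sub c by (auto simp: subgraph_def compatible_def)
  then show ?thesis using B by (auto simp: blocks_def intro: max_subgraph_subg_eq)
qed

definition BB :: "'a set set" where "BB = verts ` blocks G"

lemma inj_on_verts_blocks: "inj_on verts (blocks G)"
  by (rule inj_onI) (use block_eqI in auto)

lemma BB_sub_imp_eq: "\<lbrakk>S \<in> BB; S' \<in> BB; S \<subseteq> S'\<rbrakk> \<Longrightarrow> S = S'"
  unfolding BB_def using block_eqI by auto

lemma BB_clique: "\<lbrakk>S \<in> BB; x \<in> S; y \<in> S; x \<noteq> y\<rbrakk> \<Longrightarrow> dominates G x y"
  unfolding BB_def using block_dominates(2) by auto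

lemma BB_sub: "S \<in> BB \<Longrightarrow> S \<subseteq> verts G"
  unfolding BB_def using block_subgraph subgraph_imp_subverts by blast

lemma reachable_G: "\<lbrakk>u \<in> verts G; v \<in> verts G\<rbrakk> \<Longrightarrow> reachable G u v"
  using symmetric_connected_imp_strongly_connected[OF sym_arcs connected] by auto

lemma dominates_iff: "dominates G x y \<longleftrightarrow> x \<noteq> y \<and> (\<exists>S\<in>BB. x \<in> S \<and> y \<in> S)"
proof
  assume xy: "dominates G x y"
  then have "x \<noteq> y" using adj_not_same by blast
  moreover obtain B where "B \<in> blocks G" "x \<in> verts B" "y \<in> verts B" using dominates_in_block[OF xy] by auto
  ultimately show "x \<noteq> y \<and> (\<exists>S\<in>BB. x \<in> S \<and> y \<in> S)" by (auto simp: BB_def)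
next
  assume "x \<noteq> y \<and> (\<exists>S\<in>BB. x \<in> S \<and> y \<in> S)"
  then show "dominates G x y" using BB_clique by metis
qed

definition off_step :: "'a set \<Rightarrow> 'a \<Rightarrow> 'a \<Rightarrow> bool" where
  "off_step S x y \<longleftrightarrow> dominates G x y \<and> \<not> (x \<in> S \<and> y \<in> S)"

text \<open>The vertex of \<open>S\<close> in the component of \<open>v\<close> when the edges
  inside \<open>S\<close> are removed. Existence is \<open>gate_props\<close>, uniqueness is
  \<open>off_path_closed\<close>.\<close>

definition gate :: "'a set \<Rightarrow> 'a \<Rightarrow> 'a" where
  "gate S v = (SOME g. g \<in> S \<and> (off_step S)\<^sup>*\<^sup>* v g)"

lemma off_step_sym: "(off_step S)\<^sup>*\<^sup>* x y \<Longrightarrow> (off_step S)\<^sup>*\<^sup>* y x"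
proof (induction rule: rtranclp_induct)
  case (step y z)
  have "off_step S z y" using step(2) graph_symmetric by (auto simp: off_step_def)
  then show ?case using step(3) by (rule converse_rtranclp_into_rtranclp)
qed simp

text \<open>A path joining two vertices of \<open>S\<close> without edges of \<open>S\<close> would
  be an ear. A block containing clique and ear equals \<open>S\<close> by maximality, so the first
  edge lies inside \<open>S\<close> after all.\<close>

lemma off_path_closed:
  assumes S: "S \<in> BB" and g: "g \<in> S" "g' \<in> S" and p: "(off_step S)\<^sup>*\<^sup>* g g'"
  shows "g = g'"
proof (rule ccontr)
  assume ne: "g \<noteq> g'"
  obtain xs where xs: "xs \<noteq> []" "hd xs = g" "last xs = g'" "successively (off_step S) xs" "distinct xs"
    using rtranclp_distinct_path[OF p] by auto
  then obtain y ys where ys: "xs = g # y # ys" using ne by (cases xs; cases "tl xs") auto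
  have suc: "successively (dominates G) xs"
    using xs(4) by (rule successively_mono) (simp add: off_step_def)
  have "set xs \<subseteq> verts G"
  proof
    fix z assume "z \<in> set xs"
    then obtain as bs where ab: "xs = as @ z # bs" by (auto simp: in_set_conv_decomp)
    show "z \<in> verts G"
    proof (cases bs)
      case Nil
      then show ?thesis using ab xs(3) g BB_sub[OF S] by auto
    next
      case (Cons b bs')
      then have "dominates G z b" using suc ab by (auto simp: successively_append_iff)
      then show ?thesis by (rule adj_in_verts)
    qed
  qed
  then obtain B where B: "B \<in> blocks G" "S \<union> set xs \<subseteq> verts B"
    using clique_with_ear_in_block[of S xs] BB_sub[OF S] BB_clique[OF S] xs suc g by auto
  then have "S = verts B" using BB_sub_imp_eq[OF S, of "verts B"] by (auto simp: BB_def)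
  then have "y \<in> S" using B ys by auto
  moreover have "off_step S g y" using xs(4) ys by simp
  ultimately show False using g by (simp add: off_step_def)
qed

text \<open>Cut a walk from \<open>v\<close> to \<open>S\<close> at its first vertex in
  \<open>S\<close>.\<close>

lemma gate_props:
  assumes S: "S \<in> BB" and v: "v \<in> verts G"
  shows "gate S v \<in> S" "(off_step S)\<^sup>*\<^sup>* v (gate S v)"
proof -
  have "card S = Suc n" using S complete_blocks by (auto simp: BB_def complete_digraph_def)
  then obtain s where s: "s \<in> S" by (metis card.empty ex_in_conv nat.distinct(1))
  have "(dominates G)\<^sup>*\<^sup>* v s" using reachable_imp_rtranclp reachable_G v s BB_sub[OF S] by blast
  then have "\<exists>g. g \<in> S \<and> (off_step S)\<^sup>*\<^sup>* v g"
  proof (induction rule: converse_rtranclp_induct)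
    case base
    then show ?case using s by auto
  next
    case (step x y)
    then obtain g where g: "g \<in> S" "(off_step S)\<^sup>*\<^sup>* y g" by auto
    show ?case
    proof (cases "x \<in> S")
      case False
      then have "off_step S x y" using step by (simp add: off_step_def)
      then show ?thesis using g converse_rtranclp_into_rtranclp by metis
    qed auto
  qed
  then have "gate S v \<in> S \<and> (off_step S)\<^sup>*\<^sup>* v (gate S v)" unfolding gate_def by (rule someI_ex)
  then show "gate S v \<in> S" "(off_step S)\<^sup>*\<^sup>* v (gate S v)" by auto
qed

lemma gate_eqI:
  assumes S: "S \<in> BB" and "u \<in> verts G" "v \<in> verts G" "(off_step S)\<^sup>*\<^sup>* u v"
  shows "gate S u = gate S v"
proof (rule off_path_closed[OF S])
  show "gate S u \<in> S" "gate S v \<in> S" using gate_props S assms by auto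
  show "(off_step S)\<^sup>*\<^sup>* (gate S u) (gate S v)"
    using off_step_sym[OF gate_props(2)[OF S assms(2)]] assms(4) gate_props(2)[OF S assms(3)]
    by (meson rtranclp_trans)
qed

sublocale clique_tree "verts G" BB gate n
proof
  show "finite (verts G)" by simp
  show "n \<ge> 1" by (rule n1)
  fix S assume S: "S \<in> BB"
  show "S \<subseteq> verts G" by (rule BB_sub[OF S])
  show "card S = Suc n" using S complete_blocks by (auto simp: BB_def complete_digraph_def)
  show "gate S v \<in> S" if "v \<in> verts G" for v by (rule gate_props[OF S that])
  show "gate S v = v" if "v \<in> S" for v
  proof (rule off_path_closed[OF S _ that])
    have v: "v \<in> verts G" using that BB_sub[OF S] by auto
    show "gate S v \<in> S" "(off_step S)\<^sup>*\<^sup>* (gate S v) v"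
      using gate_props[OF S v] off_step_sym by auto
  qed
  show "gate S x = gate S y" if S': "S' \<in> BB" "S \<noteq> S'" and xy: "x \<in> S'" "y \<in> S'" for S' x y
  proof (rule gate_eqI[OF S])
    show "x \<in> verts G" "y \<in> verts G" using xy BB_sub[OF S'(1)] by auto
    \<comment> \<open>A vertex \<open>z\<close> of \<open>S'\<close> outside \<open>S\<close> is
      joined to the rest of \<open>S'\<close> by edges not inside \<open>S\<close>; hence
      \<open>S'\<close> lies in one component.\<close>
    have "\<not> S' \<subseteq> S" using BB_sub_imp_eq S S' by metis
    then obtain z where z: "z \<in> S'" "z \<notin> S" by auto
    have step: "(off_step S)\<^sup>*\<^sup>* x z" if "x \<in> S'" for x
    proof (cases "x = z")
      case False
      then have "off_step S x z" using BB_clique[OF S'(1) that z(1)] z by (simp add: off_step_def)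
      then show ?thesis by auto
    qed auto
    show "(off_step S)\<^sup>*\<^sup>* x y" using step[OF xy(1)] off_step_sym[OF step[OF xy(2)]] by (rule rtranclp_trans)
  qed
next
  fix u v assume "u \<in> verts G" "v \<in> verts G"
  then have "(dominates G)\<^sup>*\<^sup>* u v" using reachable_imp_rtranclp reachable_G by auto
  then show "(\<lambda>x y. x \<noteq> y \<and> (\<exists>B\<in>BB. x \<in> B \<and> y \<in> B))\<^sup>*\<^sup>* u v"
    by (simp only: dominates_iff)
qed

lemma adj_iff: "adj x y \<longleftrightarrow> dominates G x y"
  by (simp add: adj_def dominates_iff)

lemma deg_eq: "deg v = card {B \<in> blocks G. v \<in> verts B}"
proof -
  have "{S \<in> BB. v \<in> S} = verts ` {B \<in> blocks G. v \<in> verts B}" by (auto simp: BB_def)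
  moreover have "inj_on verts {B \<in> blocks G. v \<in> verts B}"
    using inj_on_verts_blocks by (rule inj_on_subset) auto
  ultimately show ?thesis unfolding deg_def by (simp add: card_image)
qed

text \<open>Neighbours of \<open>v\<close> in two of its blocks get separated. The gate in
  \<open>B1\<close> changes only along edges of \<open>B1\<close>, becoming the vertex reached, so a
  walk avoiding \<open>v\<close> never acquires gate \<open>v\<close>; yet \<open>w\<close> has
  it.\<close>

lemma cut_vertexI:
  assumes v: "v \<in> verts G" "deg v \<ge> 2"
  shows "cut_vertex G v"
proof -
  obtain B1 where B1: "B1 \<in> BB" "v \<in> B1"
  proof -
    have "{S \<in> BB. v \<in> S} \<noteq> {}" using v(2) unfolding deg_def by (metis card.empty not_numeral_le_zero)
    then show ?thesis using that by auto
  qed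
  obtain B2 where B2: "B2 \<in> BB" "v \<in> B2" "B2 \<noteq> B1"
    using ex_other_block[of v B1] B1 v(2) by auto
  have ex: "\<exists>u. u \<in> B \<and> u \<noteq> v" if "B \<in> BB" for B
  proof -
    have "card B \<noteq> 1" "card B \<noteq> 0" using block_card[OF that] n1 by auto
    then have "B \<noteq> {v}" "B \<noteq> {}" by auto
    then show ?thesis by auto
  qed
  obtain u where u: "u \<in> B1" "u \<noteq> v" using ex B1 by auto
  obtain w where w: "w \<in> B2" "w \<noteq> v" using ex B2 by auto
  have V: "u \<in> verts G" "w \<in> verts G" using u w B1 B2 BB_sub by auto
  have gw: "gate B1 w = v" using gate_block[OF B1(1) B2(1) B2(3)[symmetric] w(1) B2(2)] gate_id B1 by auto
  have "\<not> reachable (del_vert v) u w"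
  proof
    interpret D: wf_digraph "del_vert v" by (rule wf_digraph_del_vert)
    assume "reachable (del_vert v) u w"
    then have "gate B1 w \<noteq> v"
    proof (induction rule: D.reachable_induct)
      case base
      then show ?case using gate_id u B1 by auto
    next
      case (step x y)
      have y: "y \<noteq> v" using D.adj_in_verts[OF step(2)] by (simp add: verts_del_vert)
      have "dominates G x y" using step(2) by (auto simp: arcs_ends_def del_vert_simps ends_del_vert)
      then have xy: "adj x y" by (simp add: adj_iff)
      show ?case using gate_adj[OF B1(1) xy] step(3) y gate_id[OF B1(1), of y] by auto
    qed
    then show False using gw by simp
  qed
  then show ?thesis using v u w V reachable_G unfolding cut_vertex_def by blast
qed

lemma awalk_relpowp: "awalk u p v \<Longrightarrow> (adj ^^ length p) u v"
proof (induction p arbitrary: u)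
  case Nil
  then show ?case by (auto simp: awalk_Nil_iff)
next
  case (Cons e p)
  then have e: "e \<in> arcs G" "u = tail G e" and p: "awalk (head G e) p v"
    by (auto simp: awalk_Cons_iff)
  have "adj u (head G e)" unfolding adj_iff e(2) using e(1) by (rule in_arcs_imp_in_arcs_ends)
  then show ?case using relpowp_Suc_I2[OF _ Cons.IH[OF p]] by simp
qed

lemma relpowp_awalk: "\<lbrakk>u \<in> verts G; (adj ^^ m) u v\<rbrakk> \<Longrightarrow> \<exists>p. awalk u p v \<and> length p = m"
proof (induction m arbitrary: u)
  case 0
  then show ?case by (auto simp: awalk_Nil_iff)
next
  case (Suc m)
  obtain y where y: "adj u y" "(adj ^^ m) y v" using relpowp_Suc_D2[OF Suc.prems(2)] by auto
  obtain e where e: "e \<in> arcs G" "tail G e = u" "head G e = y" using y(1) by (auto simp: adj_iff)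
  obtain p where "awalk y p v" "length p = m" using Suc.IH[of y] y adj_V by blast
  then show ?case using e by (intro exI[of _ "e # p"]) (auto simp: awalk_Cons_iff)
qed

lemma distance_eq:
  assumes "u \<in> verts G" "v \<in> verts G"
  shows "distance G u v = ereal (real (d u v))"
proof -
  have cost: "awalk_cost (\<lambda>_. 1) p = real (length p)" for p
    by (induction p) auto
  show ?thesis
    unfolding distance_def \<mu>_def cost
  proof (rule antisym)
    obtain p where "awalk u p v" "length p = d u v" using relpowp_awalk d_walk assms by blast
    then show "(INF p\<in>{p. awalk u p v}. ereal (real (length p))) \<le> ereal (real (d u v))"
      by (intro INF_lower2[of p]) auto
    show "ereal (real (d u v)) \<le> (INF p\<in>{p. awalk u p v}. ereal (real (length p)))"
      using d_le awalk_relpowp by (intro INF_greatest) auto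
  qed
qed

lemma verts_ne: "verts G \<noteq> {}"
  using connected by (auto simp: connected_def strongly_connected_def)

lemma eccentricity_eq:
  assumes "v \<in> verts G"
  shows "eccentricity G v = ereal (real (Max (d v ` verts G)))"
proof -
  have "eccentricity G v = (SUP u\<in>verts G. ereal (real (d v u)))"
    unfolding eccentricity_def using distance_eq assms by (intro SUP_cong) auto
  then show ?thesis using SUP_ereal_Max[of "verts G" "d v"] verts_ne by simp
qed

lemma diameter_eq: "diameter G = ereal (real (Max ((\<lambda>v. Max (d v ` verts G)) ` verts G)))"
proof -
  have "diameter G = (SUP v\<in>verts G. ereal (real (Max (d v ` verts G))))"
    unfolding diameter_def using eccentricity_eq by (intro SUP_cong) auto
  then show ?thesis using SUP_ereal_Max[of "verts G" "\<lambda>v. Max (d v ` verts G)"] verts_ne by simp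
qed

lemma awalk_verts_successively: "awalk u p v \<Longrightarrow> successively adj (awalk_verts u p)"
proof (induction p arbitrary: u)
  case (Cons e p)
  then have "adj u (head G e)" "successively adj (awalk_verts (head G e) p)"
    by (auto simp: awalk_Cons_iff adj_iff in_arcs_imp_in_arcs_ends)
  moreover have "hd (awalk_verts (head G e) p) = head G e"
    using Cons.prems by (auto simp: awalk_Cons_iff)
  moreover have "tail G e = u" using Cons.prems by (simp add: awalk_Cons_iff)
  ultimately show ?case by (simp add: successively_Cons)
qed simp

lemma apath_is_path: "apath u p v \<Longrightarrow> is_path u (awalk_verts u p) v"
  using awalk_verts_successively[of u p v]
  by (auto simp: apath_def is_path_def awalk_verts_in_verts)

lemma list_awalk:
  "\<lbrakk>xs \<noteq> []; set xs \<subseteq> verts G; successively adj xs\<rbrakk> \<Longrightarrow> \<exists>p. awalk (hd xs) p (last xs) \<and> awalk_verts (hd xs) p = xs"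
proof (induction xs)
  case (Cons x xs)
  show ?case
  proof (cases xs)
    case Nil
    then show ?thesis using Cons.prems by (intro exI[of _ "[]"]) (auto simp: awalk_Nil_iff)
  next
    case (Cons y ys)
    then obtain p where p: "awalk y p (last xs)" "awalk_verts y p = xs" "adj x y"
      using Cons.IH Cons.prems by auto
    then obtain e where "e \<in> arcs G" "tail G e = x" "head G e = y" by (auto simp: adj_iff)
    then show ?thesis using p Cons by (intro exI[of _ "e # p"]) (auto simp: awalk_Cons_iff)
  qed
qed simp

lemma longest_path_length_eq:
  assumes "u \<in> verts G" "v \<in> verts G"
  shows "longest_path_length G u v = n * d u v"
  unfolding longest_path_length_def
proof (rule Max_eqI)
  have "{length p |p. apath u p v} = length ` {p. apath u p v}" by auto
  then show "finite {length p |p. apath u p v}" using apaths_finite by simp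
next
  fix l assume "l \<in> {length p |p. apath u p v}"
  then obtain p where p: "apath u p v" "l = length p" by auto
  have "length (awalk_verts u p) \<le> Suc (n * d u v)"
    by (rule path_length_le[OF assms apath_is_path[OF p(1)]])
  then show "l \<le> n * d u v" using p(2) by (simp add: length_awalk_verts)
next
  obtain xs where xs: "is_path u xs v" "length xs = Suc (n * d u v)" using ex_longest_path[OF assms] by auto
  then obtain p where "awalk u p v" "awalk_verts u p = xs" using list_awalk[of xs] by (auto simp: is_path_def)
  then have "apath u p v" "length p = n * d u v"
    using xs length_awalk_verts[of u p] by (auto simp: apath_def is_path_def)
  then show "n * d u v \<in> {length p |p. apath u p v}" by force
qed

end

section \<open>From symmetric block graphs to symmetric clique trees\<close>

lemma symmetric_block_graph_imp_clique_tree: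
  assumes G: "symmetric_block_graph (n + 1) (k + 1) dm G" and "k \<ge> 1" "n \<ge> 2" "dm \<ge> 1"
  obtains BB gate where "symmetric_clique_tree (verts G) BB gate n k dm"
    "\<And>s. symmetric_clique_tree.min_span (verts G) BB n s \<Longrightarrow> int (hc G) = s"
proof -
  have bg: "block_graph G" and dia: "diameter G = ereal (real dm)"
    and K: "\<And>B. B \<in> blocks G \<Longrightarrow> complete_digraph (n + 1) B"
    and cut: "\<And>v. cut_vertex G v \<Longrightarrow> card {B \<in> blocks G. v \<in> verts B} = k + 1"
    and ecc: "\<And>u v. \<lbrakk>u \<in> verts G; v \<in> verts G; \<not> cut_vertex G u; \<not> cut_vertex G v\<rbrakk>
        \<Longrightarrow> eccentricity G u = eccentricity G v"
    using G unfolding symmetric_block_graph_def by blast+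
  interpret graph G using bg by (simp add: block_graph_def)
  interpret clique_block_graph G n
    by unfold_locales (use bg K assms in \<open>auto simp: block_graph_def\<close>)
  have M: "Max ((\<lambda>v. Max (d v ` verts G)) ` verts G) = dm" using dia diameter_eq by simp
  have mle: "d u v \<le> dm" if "u \<in> verts G" "v \<in> verts G" for u v
  proof -
    have "d u v \<le> Max (d u ` verts G)" using that by auto
    also have "\<dots> \<le> dm" unfolding M[symmetric] using that by auto
    finally show ?thesis .
  qed
  have mex: "\<exists>u\<in>verts G. \<exists>v\<in>verts G. d u v = dm"
  proof -
    have "dm \<in> (\<lambda>v. Max (d v ` verts G)) ` verts G"
      unfolding M[symmetric] using verts_ne by (intro Max_in) auto
    then obtain u where u: "u \<in> verts G" "Max (d u ` verts G) = dm" by auto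
    have "Max (d u ` verts G) \<in> d u ` verts G" using verts_ne by (intro Max_in) auto
    then obtain v where "v \<in> verts G" "d u v = dm" unfolding u(2) by (metis imageE)
    then show ?thesis using u(1) by blast
  qed
  \<comment> \<open>A positive diameter supplies a second vertex, so every vertex has an edge and
    hence a block.\<close>
  have deg_ne: "deg v \<noteq> 0" if v: "v \<in> verts G" for v
  proof -
    obtain a b where "a \<in> verts G" "b \<in> verts G" "a \<noteq> b"
      using mex assms(4) by (metis d_self not_one_le_zero)
    then obtain a where a: "a \<in> verts G" "a \<noteq> v" by metis
    obtain B where "B \<in> BB" "v \<in> B" using ex_leaving_block[OF v a(1)] a(2) by metis
    then show ?thesis unfolding deg_def using fin_BB by auto
  qed
  have degs: "deg v = 1 \<or> deg v = Suc k" if v: "v \<in> verts G" for v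
  proof (cases "deg v = 1")
    case False
    then have "deg v \<ge> 2" using deg_ne[OF v] by linarith
    then show ?thesis using cut[OF cut_vertexI[OF v]] deg_eq by simp
  qed simp
  \<comment> \<open>Cut vertices lie in \<open>k + 1 >= 2\<close> blocks, so vertices of degree 1
    are end vertices and share their eccentricity.\<close>
  have no_cut: "\<not> cut_vertex G v" if "deg v = 1" for v
    using cut[of v] that deg_eq[of v] assms(2) by auto
  interpret S: symmetric_clique_tree "verts G" BB gate n k dm
  proof
    show "Max (d u ` verts G) = Max (d v ` verts G)"
      if "u \<in> verts G" "v \<in> verts G" "deg u = 1" "deg v = 1" for u v
      using ecc[OF that(1,2) no_cut[OF that(3)] no_cut[OF that(4)]] eccentricity_eq that by simp
  qed (use degs mle mex assms in auto)
  have ham: "hamiltonian_coloring G c \<longleftrightarrow> S.ham c" for c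
    unfolding hamiltonian_coloring_def S.ham_def using longest_path_length_eq by auto
  have "int (hc G) = s" if s: "S.min_span s" for s
  proof -
    obtain c where c: "S.ham c" "int (Max (c ` verts G)) = s" using s by (auto simp: S.min_span_def)
    have "hc G = Max (c ` verts G)"
      unfolding hc_def ham hc_coloring_def
    proof (rule Least_equality)
      show "\<exists>c'. S.ham c' \<and> Max (c' ` verts G) = Max (c ` verts G)" using c by auto
      fix y assume "\<exists>c. S.ham c \<and> Max (c ` verts G) = y"
      then obtain c' where "S.ham c'" "Max (c' ` verts G) = y" by auto
      moreover from this have "s \<le> int (Max (c' ` verts G))" using s by (auto simp: S.min_span_def)
      ultimately show "Max (c ` verts G) \<le> y" using c by simp
    qed
    then show ?thesis using c by simp
  qed
  then show ?thesis using that S.symmetric_clique_tree_axioms by blast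
qed

section \<open>Closed forms and the final formula\<close>

lemma branch_card_eq_Phi: "real (branch_card x h) = Phi (Suc h) (real x)"
proof (induction h)
  case 0
  then show ?case by (simp add: Phi_def)
next
  case (Suc h)
  have "Phi (Suc (Suc h)) (real x) = 1 + real x * Phi (Suc h) (real x)"
    unfolding Phi_def by (subst sum.lessThan_Suc_shift) (simp add: sum_distrib_left algebra_simps)
  then show ?case using Suc by simp
qed

text \<open>The left side is the sum of \<open>(i + 1) * x ^ i\<close> over \<open>i <= h\<close>:
  level \<open>i\<close> has \<open>x ^ i\<close> vertices, seen from one step above the branch.
  Clearing the denominator first makes the induction polynomial.\<close>

lemma branch_weight_closed_form:
  assumes "x \<ge> 2"
  shows "real (branch_weight x h) + real (branch_card x h)
    = real (Suc h) * real (branch_card x h) - (real (branch_card x h) - real (Suc h)) / (real x - 1)"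
proof -
  have "(real x - 1) * (real (branch_weight x h) + real (branch_card x h))
    = (real x - 1) * real (Suc h) * real (branch_card x h) - (real (branch_card x h) - real (Suc h))"
  proof (induction h)
    case (Suc h)
    let ?T = "real (branch_weight x h) + real (branch_card x h)" and ?P = "real (branch_card x h)"
    have "(real x - 1) * (real (branch_weight x (Suc h)) + real (branch_card x (Suc h)))
      = real x * ((real x - 1) * ?T) + (real x - 1) * (1 + real x * ?P)"
      by (simp add: algebra_simps)
    then show ?case unfolding Suc by (simp add: algebra_simps)
  qed simp
  moreover have "real x - 1 \<noteq> 0" using assms by simp
  ultimately show ?thesis by (simp add: field_simps)
qed

theorem theorem7:
  fixes G :: "('a, 'b) pre_digraph" and k n d r :: nat
  assumes "k \<ge> 1" and "n \<ge> 2" and "d \<ge> 3"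
    and "r = d div 2"
    and "symmetric_block_graph (n + 1) (k + 1) d G"
  shows "(even d \<longrightarrow>
      real (hc G) =
        (real n)^2 * (real k + 1) *
          (Phi r (real k * real n) * ((real k + 1) * Phi r (real k * real n) - 2 * real r)
            + 2 * (Phi r (real k * real n) - real r) / (real k * real n - 1))
        + real n) \<and>
    (odd d \<longrightarrow>
      real (hc G) =
        real k * (real n)^2 * (real n + 1) *
          (Phi r (real k * real n) * (real k * (real n + 1) * Phi r (real k * real n) - 2 * real r + 1)
            + 2 * (Phi r (real k * real n) - real r) / (real k * real n - 1)))"
proof -
  obtain BB gate where S: "symmetric_clique_tree (verts G) BB gate n k d"
    and hc: "\<And>s. symmetric_clique_tree.min_span (verts G) BB n s \<Longrightarrow> int (hc G) = s"
    using symmetric_block_graph_imp_clique_tree[OF assms(5,1,2)] assms(3) by auto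
  interpret S: symmetric_clique_tree "verts G" BB gate n k d by (rule S)
  have "r \<noteq> 0" using assms(3,4) by simp
  then obtain h where h: "r = Suc h" using not0_implies_Suc by blast
  define P where "P = Phi r (real k * real n)"
  define Q where "Q = (P - real r) / (real k * real n - 1)"
  define T where "T = real (branch_weight (k * n) h) + real (branch_card (k * n) h)"
  have P: "real (branch_card (k * n) h) = P" unfolding P_def h by (simp add: branch_card_eq_Phi)
  have T: "T = real r * P - Q"
    using branch_weight_closed_form[OF S.kn_ge, of h] by (simp add: T_def P Q_def h)
  have Q2: "2 * (P - real r) / (real k * real n - 1) = 2 * Q" by (simp add: Q_def)
  have even_case: "real (hc G) = (real n)^2 * (real k + 1) * (P * ((real k + 1) * P - 2 * real r) + 2 * Q) + real n"
    if "even d"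
  proof -
    have d: "d = 2 * Suc h" "h \<ge> 1" using that assms(3,4) h by auto
    define m where "m = Suc k * (n * branch_card (k * n) h)"
    define W where "W = Suc k * (n * (branch_weight (k * n) h + branch_card (k * n) h))"
    have "int (hc G) = int m * int m - int n * (2 * int W - 1)"
      by (rule hc[OF S.min_span_even[OF d m_def W_def]])
    then have "real (hc G) = real m * real m - real n * (2 * real W - 1)"
      by (metis (mono_tags, lifting) of_int_1 of_int_diff of_int_mult of_int_numeral of_int_of_nat_eq)
    moreover have "real m = (real k + 1) * (real n * P)" by (simp add: m_def P algebra_simps)
    moreover have "real W = (real k + 1) * (real n * T)" by (simp add: W_def T_def algebra_simps)
    ultimately show ?thesis unfolding T by (simp add: algebra_simps power2_eq_square)
  qed
  have odd_case: "real (hc G) = real k * (real n)^2 * (real n + 1) * (P * (real k * (real n + 1) * P - 2 * real r + 1) + 2 * Q)"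
    if "odd d"
  proof -
    have d: "d = Suc (2 * Suc h)" using that assms(3,4) h by (metis odd_two_times_div_two_succ Suc_eq_plus1)
    \<comment> \<open>The order minus one, written without truncated subtraction.\<close>
    define m where "m = n + Suc n * (k * n * branch_card (k * n) h)"
    define W where "W = Suc n * branch_weight (k * n) (Suc h)"
    have m: "Suc m = Suc n * branch_card (k * n) (Suc h)" by (simp add: m_def)
    have "int (hc G) = int m * int m - int n * (2 * int W + int m)"
      by (rule hc[OF S.min_span_odd[OF d m W_def]])
    then have "real (hc G) = real m * real m - real n * (2 * real W + real m)"
      by (metis (mono_tags, lifting) of_int_add of_int_diff of_int_mult of_int_numeral of_int_of_nat_eq)
    moreover have "real m = real n + (real n + 1) * (real k * real n * P)" by (simp add: m_def P algebra_simps)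
    \<comment> \<open>One unfolding of \<open>branch_weight\<close> leaves branches of height
      \<open>h\<close>, so the same \<open>T\<close> serves both parities.\<close>
    moreover have "real W = (real n + 1) * (real k * real n * T)" by (simp add: W_def T_def algebra_simps)
    ultimately show ?thesis unfolding T by (simp add: algebra_simps power2_eq_square)
  qed
  show ?thesis using even_case odd_case unfolding P_def[symmetric] Q2 by blast
qed

end
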